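(* Let $n>1$ be an integer. There are constants $\epsilon_0,\delta_0,r_0>0$, depending only on $n$, such that the following holds. Let $0<\epsilon\le\epsilon_0$, $0<\delta\le\delta_0$, and put $$r=2\epsilon\sqrt{\ln\frac{3C_n}{\epsilon^{2n-1}}},\qquad a_n=\frac{2\log_2\log_2(5n)}{\log_2(5n)}.$$ Let $S$ consist of $k$ i.i.d. random elements of $SO_{n+1}$ drawn from the Haar probability measure, where $$k\ \ge\ 8\ln 2\left((n+4)+2\ln\frac1\delta+6n(1+a_n)\ln\frac1\epsilon-\ln(n!)\right),$$ and let $\hat S=S\sqcup S^{-1}$ be the multiset of all elements of $S$ and their inverses. Let $x_0\in S^n$, let $$l=\left\lceil\frac n2\log_2\frac1{r\epsilon}+(4+3a_n)\log_2\frac1\epsilon\right\rceil,$$ and let $\nu$ be the probability measure on $S^n$ uniformly supported on $\hat S^lx_0$, i.e. $$\nu=\frac1{(2k)^l}\sum_{w\in\hat S^l}\delta_{wx_0}.$$ If $r\le r_0$, then with probability at least $1-\delta$, $$W_1(\sigma,\nu)\le\epsilon .$$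
   Context: $S^n\subset\mathbb R^{n+1}$ is the unit sphere and $\sigma$ the probability measure on $S^n$ induced by the Haar probability measure of $SO_{n+1}$ (the rotation-invariant probability measure). $\hat S^l$ denotes the multiset of all $(2k)^l$ words (products) of length $l$ in the elements of $\hat S$, acting on $S^n$ by rotations. $W_1$ is the $1$-Wasserstein distance: for Borel probability measures $\mu,\nu$ on $S^n$, $W_1(\mu,\nu)=\inf_\lambda\int_{S^n\times S^n}d(x,y)\,d\lambda(x,y)$, the infimum over all couplings $\lambda$ of $\mu$ and $\nu$. Here $d(x,y)=\|x-y\|=\sqrt2\,(1-\langle x,y\rangle)^{1/2}$. Constant $C_n$: let $H_t(x_0,x)$ be the heat kernel on $S^n$ with respect to $\sigma$, i.e. the fundamental solution of $\partial_t u=\Delta^{LB}u$ with $u(t,\cdot)\to\delta_{x_0}$ weak-$*$ as $t\to0^+$, where $\Delta^{LB}$ is the (nonpositive) Laplace–Beltrami operator. It is known that there is a constant $C_{S^n}>0$ depending only on $n$ such that $$H_t(x_0,x)\le C_{S^n}\,t^{-n+\frac12}\exp\left(-\frac{(\arccos\langle x_0,x\rangle)^2}{4t}\right)$$ for all $x_0,x\in S^n$ and $0<t\le1$. Fix such a constant and set $C_n:=1+C_{S^n}$. *)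

theory Defs
  imports "HOL-Probability.Probability"
begin

abbreviation unit_sphere :: "'a::euclidean_space set" where
  "unit_sphere \<equiv> sphere 0 1"

abbreviation sphere_borel :: "'a::euclidean_space measure" where
  "sphere_borel \<equiv> restrict_space borel unit_sphere"

abbreviation SO :: "(real^'n^'n) set" where
  "SO \<equiv> {A. rotation_matrix A}"

definition is_haar_SO :: "(real^'n^'n) measure \<Rightarrow> bool" where
  "is_haar_SO \<mu> \<longleftrightarrow> prob_space \<mu> \<and> sets \<mu> = sets (restrict_space borel SO) \<and>
     (\<forall>g\<in>SO. distr \<mu> \<mu> (\<lambda>A. g ** A) = \<mu>)"

text \<open>The orbit map of any base point gives the same measure, because \<^term>\<open>SO\<close> acts
  transitively on the sphere (in dimension at least 2) and Haar measure on a compact group is also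
  right-invariant. Hence the arbitrary choice below is harmless.\<close>

definition sphere_measure :: "(real^'n^'n) measure \<Rightarrow> (real^'n) measure" where
  "sphere_measure \<mu> = distr \<mu> sphere_borel (\<lambda>A. A *v (SOME p. p \<in> unit_sphere))"

definition couplings :: "'a measure \<Rightarrow> 'b measure \<Rightarrow> ('a \<times> 'b) measure set" where
  "couplings \<mu> \<nu> = {\<pi>. prob_space \<pi> \<and> sets \<pi> = sets (\<mu> \<Otimes>\<^sub>M \<nu>) \<and>
     distr \<pi> \<mu> fst = \<mu> \<and> distr \<pi> \<nu> snd = \<nu>}"

definition wasserstein1 :: "'a::metric_space measure \<Rightarrow> 'a measure \<Rightarrow> ennreal" where
  "wasserstein1 \<mu> \<nu> = (INF \<pi>\<in>couplings \<mu> \<nu>. \<integral>\<^sup>+ p. ennreal (dist (fst p) (snd p)) \<partial>\<pi>)"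

text \<open>The Laplace--Beltrami operator of the round unit sphere: the Euclidean Laplacian of the
  extension of \<open>f\<close> that is constant along rays, \<open>x \<mapsto> f (x / \<parallel>x\<parallel>)\<close> (note that
  \<^term>\<open>sgn x\<close> is \<open>x / \<parallel>x\<parallel>\<close>).\<close>

definition laplacian :: "('a::euclidean_space \<Rightarrow> real) \<Rightarrow> 'a \<Rightarrow> real" where
  "laplacian F x = (\<Sum>b\<in>Basis. (deriv ^^ 2) (\<lambda>s. F (x + s *\<^sub>R b)) 0)"

definition laplace_beltrami :: "('a::euclidean_space \<Rightarrow> real) \<Rightarrow> 'a \<Rightarrow> real" where
  "laplace_beltrami f = laplacian (\<lambda>x. f (sgn x))"

text \<open>Meant for open \<open>U\<close>, where the derivative \<open>f'\<close> is unique on \<open>U\<close>.\<close>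

fun Ck_on :: "nat \<Rightarrow> ('a::euclidean_space \<Rightarrow> real) \<Rightarrow> 'a set \<Rightarrow> bool" where
  "Ck_on 0 f U \<longleftrightarrow> continuous_on U f"
| "Ck_on (Suc k) f U \<longleftrightarrow>
     (\<exists>f'. (\<forall>x\<in>U. (f has_derivative f' x) (at x)) \<and> (\<forall>h. Ck_on k (\<lambda>x. f' x h) U))"

text \<open>\<open>H t x\<^sub>0 x\<close> is the fundamental solution of the heat equation on the sphere, as a density with
  respect to \<open>\<sigma>\<close>: a classical solution on \<open>(0,\<infinity>) \<times> S\<^sup>n\<close> that tends weak-* to the Dirac measure at
  \<open>x\<^sub>0\<close> as \<open>t \<rightarrow> 0+\<close>. Smoothness on the sphere is smoothness of the extension constant along rays.
  These conditions determine \<open>H t x\<^sub>0 x\<close> for \<open>t > 0\<close> and \<open>x\<^sub>0\<close>, \<open>x\<close> on the sphere.\<close>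

definition is_heat_kernel ::
    "('a::euclidean_space) measure \<Rightarrow> (real \<Rightarrow> 'a \<Rightarrow> 'a \<Rightarrow> real) \<Rightarrow> bool" where
  "is_heat_kernel \<sigma> H \<longleftrightarrow> (\<forall>x0\<in>unit_sphere.
     Ck_on 2 (\<lambda>(t, x). H t x0 (sgn x)) ({0<..} \<times> (- {0})) \<and>
     (\<forall>t>0. \<forall>x\<in>unit_sphere.
        ((\<lambda>s. H s x0 x) has_real_derivative laplace_beltrami (H t x0) x) (at t)) \<and>
     (\<forall>\<phi> :: 'a \<Rightarrow> real. continuous_on unit_sphere \<phi> \<longrightarrow>
        ((\<lambda>t. \<integral>x. \<phi> x * H t x0 x \<partial>\<sigma>) \<longlongrightarrow> \<phi> x0) (at_right 0)))"

definition heat_kernel_bound ::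
    "nat \<Rightarrow> (real \<Rightarrow> 'a::euclidean_space \<Rightarrow> 'a \<Rightarrow> real) \<Rightarrow> real \<Rightarrow> bool" where
  "heat_kernel_bound n H C \<longleftrightarrow> C > 0 \<and>
     (\<forall>x0\<in>unit_sphere. \<forall>x\<in>unit_sphere. \<forall>t. 0 < t \<and> t \<le> 1 \<longrightarrow>
        H t x0 x \<le> C * t powr (- real n + 1/2) * exp (- (arccos (x0 \<bullet> x))\<^sup>2 / (4 * t)))"

text \<open>The multiset \<open>S \<squnion> S\<^sup>-\<^sup>1\<close> is indexed by letters \<open>(i, b)\<close> with \<open>i < k\<close>, where \<open>b\<close> tells whether
  \<open>S i\<close> or its inverse is meant; summing over words in these letters counts multiplicities.\<close>

definition letter :: "(nat \<Rightarrow> real^'n^'n) \<Rightarrow> nat \<times> bool \<Rightarrow> real^'n^'n" where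
  "letter S = (\<lambda>(i, b). if b then S i else matrix_inv (S i))"

definition words :: "nat \<Rightarrow> nat \<Rightarrow> (nat \<times> bool) list set" where
  "words k l = {w. set w \<subseteq> {..<k} \<times> UNIV \<and> length w = l}"

definition word_product :: "(nat \<Rightarrow> real^'n^'n) \<Rightarrow> (nat \<times> bool) list \<Rightarrow> real^'n^'n" where
  "word_product S w = foldr (\<lambda>a A. letter S a ** A) w (mat 1)"

definition orbit_measure ::
    "(nat \<Rightarrow> real^'n^'n) \<Rightarrow> nat \<Rightarrow> nat \<Rightarrow> real^'n \<Rightarrow> (real^'n) measure" where
  "orbit_measure S k l x0 =
     distr (uniform_count_measure (words k l)) sphere_borel (\<lambda>w. word_product S w *v x0)"

definition a_const :: "nat \<Rightarrow> real" where
  "a_const n = 2 * log 2 (log 2 (5 * real n)) / log 2 (5 * real n)"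

end

(*
  Let f be the normalised indicator of a cap of radius eps/2. Averaging its translates over the words
  w gives a density g that is eps/2-close to nu in W_1, and an explicit coupling gives
  W_1(sigma, nu) <= eps/2 + ||g - 1||_1. The random variable Z = ||g - 1||_2^2 is the average of
  K(u x0, v x0) over pairs of words, with a kernel K of mean zero in each variable. Hence in the
  expansion of E(Z^p) every term vanishes in which some generator occurs exactly once among the 2lp
  letters. Few terms survive, and Markov's inequality for a moment p of order k/(8l) gives the
  exponentially small failure probability.
*)
theory Submission
  imports Defs "HOL-Real_Asymp.Real_Asymp"
begin

section \<open>Counting words without a letter that occurs once\<close>

text \<open>Words share generators, so the factors of a moment are strongly dependent. A generator
  occurring once still gives cancellation: with the others fixed, its word carries the base point to
  a uniform point. Occurrences must be counted across all 2p words together; among words of length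
  2j the surviving fraction is at most about (4j/(ek))^j.

  The cap density costs a factor B of order at most eps^-(n+3) per moment: n+1 from a crude
  pigeonhole bound on the cap measure, 2 from Markov's inequality at level eps/2. Since l is at
  least (n + 7/2) log_2(1/eps), B is beaten by 2^l with room to spare, so B^p merely doubles the
  base of that power. With j = lp between k/16 and k/8 the outcome is exp(-5k/48), whatever l is;
  this dictates the size of p.

  A second obstacle is measurability: an infimum over couplings is not visibly measurable in S, and
  the probability of a nonmeasurable set is 0 by convention, so no lower bound is possible without
  it. It follows from Lipschitz dependence of W_1 on the finitely many points.\<close>

lemma finite_words: "finite (words k l)"
  unfolding words_def by (rule finite_lists_length_eq) simp

lemma card_words: "card (words k l) = (2 * k) ^ l"
  unfolding words_def by (subst card_lists_length_eq) (simp_all add: card_cartesian_product)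

lemma words_0: "words k 0 = {[]}"
  by (auto simp: words_def)

lemma words_nonempty: "k \<ge> 1 \<Longrightarrow> words k l \<noteq> {}"
  using card_words[of k l] by (metis card.empty mult_is_0 not_one_le_zero power_not_zero zero_neq_numeral)

lemma sum_words_add: "(\<Sum>w\<in>words k (a + b). h w) = (\<Sum>u\<in>words k a. \<Sum>v\<in>words k b. h (u @ v))"
proof -
  have "bij_betw (\<lambda>(u, v). u @ v) (words k a \<times> words k b) (words k (a + b))"
    by (rule bij_betw_byWitness[where f' = "\<lambda>w. (take a w, drop a w)"])
       (auto simp: words_def dest: in_set_takeD in_set_dropD)
  from sum.reindex_bij_betw[OF this, of h] show ?thesis
    by (simp add: sum.cartesian_product split_def)
qed

lemma sum_words_Suc: "(\<Sum>w\<in>words k (Suc l). h w) = (\<Sum>a\<in>{..<k} \<times> UNIV. \<Sum>v\<in>words k l. h (a # v))"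
proof -
  have "words k 1 = (\<lambda>a. [a]) ` ({..<k} \<times> UNIV)"
    by (auto simp: words_def length_Suc_conv)
  then show ?thesis
    using sum_words_add[of h k 1 l]
    by (simp add: sum.reindex inj_on_def)
qed

text \<open>The letter and the inverse letter of index i carry the same weight \<open>x i\<close>,
  hence the factor 2.\<close>

lemma power_sum_words:
  fixes x :: "nat \<Rightarrow> real"
  shows "(2 * (\<Sum>i<k. x i)) ^ N = (\<Sum>w\<in>words k N. \<Prod>a\<leftarrow>w. x (fst a))"
proof (induction N)
  case 0
  show ?case by (simp add: words_0)
next
  case (Suc N)
  have "(\<Sum>a\<in>{..<k} \<times> (UNIV :: bool set). x (fst a)) = 2 * (\<Sum>i<k. x i)"
    by (subst sum.cartesian_product') (simp add: UNIV_bool sum.distrib sum_distrib_left)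
  then have "(2 * (\<Sum>i<k. x i)) ^ Suc N
      = (\<Sum>a\<in>{..<k} \<times> (UNIV :: bool set). x (fst a)) * (\<Sum>w\<in>words k N. \<Prod>a\<leftarrow>w. x (fst a))"
    by (simp only: power_Suc Suc)
  then show ?case
    by (simp add: sum_words_Suc sum_product)
qed

lemma prod_word_eq_prod_count:
  fixes x :: "nat \<Rightarrow> real"
  assumes "w \<in> words k N"
  shows "(\<Prod>a\<leftarrow>w. x (fst a)) = (\<Prod>i<k. x i ^ count_list (map fst w) i)"
  using assms
proof (induction w arbitrary: N)
  case Nil
  then show ?case by simp
next
  case (Cons a w)
  then have a: "fst a < k" and w: "w \<in> words k (N - 1)"
    by (auto simp: words_def)
  have "(\<Prod>i<k. x i ^ count_list (map fst (a # w)) i)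
      = (\<Prod>i<k. (if i = fst a then x i else 1) * x i ^ count_list (map fst w) i)"
    by (intro prod.cong) auto
  also have "\<dots> = x (fst a) * (\<Prod>i<k. x i ^ count_list (map fst w) i)"
    using a by (simp add: prod.distrib prod.delta)
  finally show ?case using Cons.IH[OF w] by simp
qed

lemma power_over_fact_le_exp: "(x::real) \<ge> 0 \<Longrightarrow> x ^ n / fact n \<le> exp x"
proof -
  assume x: "x \<ge> 0"
  have "(\<Sum>i\<in>{n}. inverse (fact i) * x ^ i) \<le> (\<Sum>i. inverse (fact i) * x ^ i)"
    by (rule sum_le_suminf[OF summable_exp]) (use x in auto)
  then show ?thesis
    by (simp add: exp_def divide_inverse mult.commute)
qed

text \<open>A two-point law with mean zero all of whose higher moments are at least one. In the proof of
  \<open>card_words_no_single\<close> it turns the indicator of ``no index occurs exactly once'' into an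
  expectation.\<close>

abbreviation (input) two_point_mean :: "(real \<Rightarrow> real) \<Rightarrow> real" where
  "two_point_mean g \<equiv> 2/7 * g (5/3) + 5/7 * g (-2/3)"

text \<open>The law has to be skewed, since a symmetric one has third moment 0. Here the second and
  third moments are both 10/9, and from s = 4 on the atom 5/3 outweighs the other one whatever the
  sign of (-2/3)^s.\<close>

lemma two_point_moment_ge:
  assumes "s \<noteq> 1"
  shows "two_point_mean (\<lambda>x. x ^ s) \<ge> 1"
proof -
  consider "s = 0" | "s = 2" | "s = 3" | "s \<ge> 4" using assms by linarith
  then show ?thesis
  proof cases
    case 4
    have "(5/3 :: real) ^ 4 \<le> (5/3) ^ s" using 4 by (intro power_increasing) auto
    moreover have "\<bar>(-2/3 :: real) ^ s\<bar> \<le> (2/3) ^ 4"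
      using power_decreasing[of 4 s "2/3::real"] 4 by (simp add: power_abs)
    then have "- (16/81) \<le> (-2/3 :: real) ^ s"
      unfolding abs_le_iff by (simp add: power4_eq_xxxx)
    ultimately show ?thesis by (simp add: power4_eq_xxxx)
  qed (auto simp: power2_eq_square power3_eq_cube)
qed

text \<open>Hoeffding's lemma: the atoms are 7/3 apart and (7/3)^2 / 8 <= 1.\<close>

lemma two_point_exp_le: "two_point_mean (\<lambda>x. exp (z * x)) \<le> exp (z\<^sup>2)"
proof -
  have pos: "p * exp (l * a) + (1 - p) * exp (- l * b) \<le> exp (l\<^sup>2)"
    if l: "l > 0" and ab: "a \<ge> 0" "b \<ge> 0" "(a + b)\<^sup>2 \<le> 8" and p: "0 \<le> p" "p \<le> 1"
      and mean: "p * a - (1 - p) * b = 0" for l a b p :: real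
  proof -
    define f where "f = (\<lambda>t. if t then a else - b)"
    interpret interval_bounded_random_variable "measure_pmf (bernoulli_pmf p)" f "- b" a
      using ab by unfold_locales (auto simp: f_def)
    have "measure_pmf.expectation (bernoulli_pmf p) f = 0"
      using p mean by (simp add: f_def algebra_simps)
    from Hoeffdings_lemma_nn_integral_0[OF l this]
    have "ennreal p * ennreal (exp (l * a)) + ennreal (1 - p) * ennreal (exp (l * - b))
        \<le> ennreal (exp (l\<^sup>2 * (a + b)\<^sup>2 / 8))"
      using p by (simp add: f_def mult.commute add.commute)
    then have "ennreal (p * exp (l * a) + (1 - p) * exp (l * - b)) \<le> ennreal (exp (l\<^sup>2 * (a + b)\<^sup>2 / 8))"
      using p by (simp add: ennreal_mult' ennreal_plus)
    then have "p * exp (l * a) + (1 - p) * exp (- l * b) \<le> exp (l\<^sup>2 * (a + b)\<^sup>2 / 8)"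
      by (simp add: ennreal_le_iff)
    also have "\<dots> \<le> exp (l\<^sup>2)"
      using mult_left_mono[OF ab(3), of "l\<^sup>2"] by simp
    finally show ?thesis .
  qed
  \<comment> \<open>Hoeffding's lemma needs a positive parameter, so z < 0 is treated with the
    reflected law.\<close>
  consider "z > 0" | "z = 0" | "z < 0" by linarith
  then show ?thesis
  proof cases
    case 1
    then show ?thesis using pos[of z "5/3" "2/3" "2/7"] by (simp add: power2_eq_square)
  next
    case 3
    then show ?thesis using pos[of "-z" "2/3" "5/3" "5/7"] by (simp add: power2_eq_square)
  qed simp
qed

text \<open>Let X_i be independent with the two-point law. Expanding E((2 sum X_i)^N) over all words
  gives products of moments, at least 1 if no index occurs once and nonnegative in any case, so this
  expectation dominates the count. It is then bounded through the exponential moment; z stays free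
  for a later optimisation.\<close>

lemma card_words_no_single:
  fixes z :: real
  assumes N: "even N" and z: "z > 0"
  shows "real (card {w \<in> words k N. \<forall>i. count_list (map fst w) i \<noteq> 1})
    \<le> 2 * fact N * (2 / z) ^ N * exp (real k * z\<^sup>2)"
proof -
  \<comment> \<open>The product law is encoded as a finite weighted sum. The weight \<open>p\<close>
    is nonnegative also off the two atoms, so monotonicity of \<open>E\<close> needs no membership
    condition.\<close>
  define p :: "real \<Rightarrow> real" where "p = (\<lambda>x. if x = 5/3 then 2/7 else 5/7)"
  define V :: "real set" where "V = {5/3, -2/3}"
  define E :: "((nat \<Rightarrow> real) \<Rightarrow> real) \<Rightarrow> real"
    where "E = (\<lambda>h. \<Sum>x\<in>{..<k} \<rightarrow>\<^sub>E V. (\<Prod>i<k. p (x i)) * h x)"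
  have V: "finite V" "(\<Sum>v\<in>V. p v * g v) = two_point_mean g" for g
    by (simp_all add: V_def p_def)
  have p0: "p v \<ge> 0" for v by (simp add: p_def)
  have E_prod: "E (\<lambda>x. \<Prod>i<k. g i (x i)) = (\<Prod>i<k. two_point_mean (g i))" for g
  proof -
    have "E (\<lambda>x. \<Prod>i<k. g i (x i)) = (\<Sum>x\<in>{..<k} \<rightarrow>\<^sub>E V. \<Prod>i<k. p (x i) * g i (x i))"
      by (simp add: E_def prod.distrib)
    also have "\<dots> = (\<Prod>i<k. \<Sum>v\<in>V. p v * g i v)"
      using V(1) by (subst prod_sum_PiE) auto
    finally show ?thesis by (simp add: V(2))
  qed
  have E_mono: "E g \<le> E h" if "\<And>x. g x \<le> h x" for g h
    unfolding E_def by (intro sum_mono mult_left_mono that prod_nonneg) (auto simp: p0)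
  have E_exp: "E (\<lambda>x. \<Prod>i<k. exp (c * x i)) \<le> exp (c\<^sup>2) ^ k" for c
    unfolding E_prod[of "\<lambda>_ y. exp (c * y)"] prod_constant card_lessThan
    by (intro power_mono two_point_exp_le) simp
  define m where "m = (\<lambda>s. two_point_mean (\<lambda>x. x ^ s))"
  have m1: "m s \<ge> 1" if "s \<noteq> 1" for s
    using two_point_moment_ge[OF that] by (simp add: m_def)
  \<comment> \<open>The only exceptional moment is the mean, which is exactly 0: words with a single
    index are counted with weight 0, never negatively.\<close>
  have m0: "m s \<ge> 0" for s
    using m1[of s] by (cases "s = 1") (auto simp: m_def)
  have "real (card {w \<in> words k N. \<forall>i. count_list (map fst w) i \<noteq> 1})
      = (\<Sum>w\<in>words k N. if \<forall>i. count_list (map fst w) i \<noteq> 1 then 1 else 0)"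
    by (simp add: sum.If_cases finite_words Int_def)
  also have "\<dots> \<le> (\<Sum>w\<in>words k N. \<Prod>i<k. m (count_list (map fst w) i))"
  proof (rule sum_mono)
    fix w :: "(nat \<times> bool) list"
    show "(if \<forall>i. count_list (map fst w) i \<noteq> 1 then 1 else 0) \<le> (\<Prod>i<k. m (count_list (map fst w) i))"
    proof (cases "\<forall>i. count_list (map fst w) i \<noteq> 1")
      case True
      then show ?thesis unfolding if_P[OF True] by (intro prod_ge_1 m1) blast
    next
      case False
      show ?thesis unfolding if_not_P[OF False] by (intro prod_nonneg m0)
    qed
  qed
  also have "\<dots> = (\<Sum>w\<in>words k N. E (\<lambda>x. \<Prod>a\<leftarrow>w. x (fst a)))"
    unfolding m_def by (intro sum.cong refl)
       (simp only: E_prod[of "\<lambda>i y. y ^ count_list (map fst w) i" for w, symmetric]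
          prod_word_eq_prod_count)
  also have "\<dots> = E (\<lambda>x. (2 * (\<Sum>i<k. x i)) ^ N)"
    unfolding power_sum_words E_def by (subst sum.swap) (simp only: sum_distrib_left)
  also have "\<dots> \<le> E (\<lambda>x. fact N * (2 / z) ^ N * ((\<Prod>i<k. exp (z * x i)) + (\<Prod>i<k. exp (- z * x i))))"
  proof (rule E_mono)
    fix x :: "nat \<Rightarrow> real"
    let ?s = "\<Sum>i<k. x i"
    have "(2 * ?s) ^ N = fact N * (2 / z) ^ N * ((z * \<bar>?s\<bar>) ^ N / fact N)"
      using z N by (simp add: power_mult_distrib power_divide power_even_abs)
    also have "\<dots> \<le> fact N * (2 / z) ^ N * exp (z * \<bar>?s\<bar>)"
      using z by (intro mult_left_mono power_over_fact_le_exp) auto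
    also have "exp (z * \<bar>?s\<bar>) \<le> exp (z * ?s) + exp (- z * ?s)"
      by (cases "?s \<ge> 0") auto
    finally show "(2 * ?s) ^ N
        \<le> fact N * (2 / z) ^ N * ((\<Prod>i<k. exp (z * x i)) + (\<Prod>i<k. exp (- z * x i)))"
      using z by (simp add: exp_sum[symmetric] sum_distrib_left sum_negf mult_left_mono)
  qed
  also have "\<dots> = fact N * (2 / z) ^ N *
      (E (\<lambda>x. \<Prod>i<k. exp (z * x i)) + E (\<lambda>x. \<Prod>i<k. exp (- z * x i)))"
    by (simp add: E_def sum_distrib_left sum.distrib algebra_simps)
  also have "\<dots> \<le> fact N * (2 / z) ^ N * (exp (z\<^sup>2) ^ k + exp ((- z)\<^sup>2) ^ k)"
    using z by (intro mult_left_mono add_mono E_exp) auto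
  finally show ?thesis by (simp add: exp_of_nat_mult[symmetric])
qed

section \<open>Haar measure on the rotation group\<close>

lemma borel_measurable_mat_vec [measurable]:
  fixes f :: "'a \<Rightarrow> real^'n^'m" and g :: "'a \<Rightarrow> real^'n"
  assumes [measurable]: "f \<in> borel_measurable M" "g \<in> borel_measurable M"
  shows "(\<lambda>x. f x *v g x) \<in> borel_measurable M"
  by (rule borel_measurable_continuous_Pair)
     (auto simp: matrix_vector_mult_def intro!: continuous_intros)

lemma borel_measurable_transpose [measurable]:
  fixes f :: "'a \<Rightarrow> real^'n^'m"
  assumes [measurable]: "f \<in> borel_measurable M"
  shows "(\<lambda>x. transpose (f x)) \<in> borel_measurable M"
proof -
  have "continuous_on UNIV (transpose :: real^'n^'m \<Rightarrow> _)"
    unfolding transpose_def by (auto intro!: continuous_intros)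
  then show ?thesis using assms by (rule borel_measurable_continuous_on)
qed

declare transpose_matrix_vector [simp del]

lemma SO_transpose: "A \<in> SO \<Longrightarrow> transpose A \<in> SO"
  by (simp add: rotation_matrix_def)

lemma SO_mult: "A \<in> SO \<Longrightarrow> B \<in> SO \<Longrightarrow> A ** B \<in> SO"
  by (simp add: rotation_matrix_def orthogonal_matrix_mul det_mul)

lemma norm_SO: "A \<in> SO \<Longrightarrow> norm (A *v x) = norm x"
  by (intro orthogonal_transformation_norm)
     (simp add: orthogonal_transformation_matrix rotation_matrix_def)

lemma SO_sphere: "A \<in> SO \<Longrightarrow> x \<in> unit_sphere \<Longrightarrow> A *v x \<in> unit_sphere"
  by (simp add: norm_SO)

lemma matrix_inv_SO:
  assumes "A \<in> SO"
  shows "matrix_inv A = transpose A"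
proof -
  have *: "A ** transpose A = mat 1" "transpose A ** A = mat 1"
    using assms by (auto simp: rotation_matrix_def orthogonal_matrix_def)
  then have "A ** matrix_inv A = mat 1"
    unfolding matrix_inv_def by (rule someI2[where a = "transpose A", OF conjI]) simp
  then have "(transpose A ** A) ** matrix_inv A = transpose A"
    by (simp add: matrix_mul_assoc[symmetric])
  then show ?thesis by (simp add: *)
qed

lemma SO_transitive:
  fixes x y :: "real^'n"
  assumes "CARD('n) \<ge> 2" "x \<in> unit_sphere" "y \<in> unit_sphere"
  obtains A where "A \<in> SO" "A *v x = y"
proof -
  obtain f where f: "orthogonal_transformation f" "det (matrix f) = 1" "f x = y"
    using rotation_exists[of x y] assms by auto
  then have "matrix f \<in> SO" "matrix f *v x = y"
    by (auto simp: rotation_matrix_def orthogonal_transformation_matrix matrix_works linear_matrix_vector_mul_eq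
          matrix_vector_mul)
  then show ?thesis using that by blast
qed

lemma space_sphere_borel [simp]: "space sphere_borel = unit_sphere"
  by (simp add: space_restrict_space)

lemma measurable_sphere_borelI:
  "f \<in> borel_measurable M \<Longrightarrow> (\<And>x. x \<in> space M \<Longrightarrow> f x \<in> unit_sphere) \<Longrightarrow> f \<in> measurable M sphere_borel"
  by (rule measurable_restrict_space2) auto

lemma measurable_sphere_borelD: "f \<in> measurable M sphere_borel \<Longrightarrow> f \<in> borel_measurable M"
  by (simp add: measurable_restrict_space2_iff)

locale haar_SO = prob_space \<mu> for \<mu> :: "(real^'n^'n) measure" +
  assumes haar: "is_haar_SO \<mu>" and card2: "CARD('n) \<ge> 2"
begin

abbreviation \<sigma> :: "(real^'n) measure" where "\<sigma> \<equiv> sphere_measure \<mu>"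

lemma sets_haar [measurable_cong]: "sets \<mu> = sets (restrict_space borel SO)"
  using haar by (simp add: is_haar_SO_def)

lemma space_haar [simp]: "space \<mu> = SO"
  using sets_eq_imp_space_eq[OF sets_haar] by (simp add: space_restrict_space)

lemma measurable_haarD: "f \<in> measurable M \<mu> \<Longrightarrow> f \<in> borel_measurable M"
  by (simp add: measurable_cong_sets[OF refl sets_haar] measurable_restrict_space2_iff)

lemma id_borel_haar [measurable]: "(\<lambda>A. A) \<in> borel_measurable \<mu>"
  by (rule measurable_haarD) simp

lemma orbit_measurable: "z \<in> unit_sphere \<Longrightarrow> (\<lambda>A. A *v z) \<in> measurable \<mu> sphere_borel"
  by (intro measurable_sphere_borelI) (auto simp: norm_SO)

lemma orbit_transpose_measurable:
  "z \<in> unit_sphere \<Longrightarrow> (\<lambda>A. transpose A *v z) \<in> measurable \<mu> sphere_borel"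
  by (intro measurable_sphere_borelI) (auto simp: norm_SO SO_transpose[simplified])

lemma left_mult_measurable:
  assumes "B \<in> SO"
  shows "(\<lambda>A. B ** A) \<in> measurable \<mu> \<mu>"
proof -
  have "continuous_on UNIV (\<lambda>A. B ** A)"
    unfolding matrix_matrix_mult_def by (auto intro!: continuous_intros)
  from borel_measurable_continuous_on[OF this id_borel_haar]
  show ?thesis
    unfolding measurable_cong_sets[OF refl sets_haar]
    by (intro measurable_restrict_space2) (use assms in \<open>auto intro: SO_mult[simplified]\<close>)
qed

lemma nn_integral_left_mult:
  assumes "B \<in> SO" "h \<in> borel_measurable \<mu>"
  shows "(\<integral>\<^sup>+A. h (B ** A) \<partial>\<mu>) = (\<integral>\<^sup>+A. h A \<partial>\<mu>)"
proof -
  have "(\<integral>\<^sup>+A. h A \<partial>\<mu>) = (\<integral>\<^sup>+A. h A \<partial>distr \<mu> \<mu> (\<lambda>A. B ** A))"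
    using haar assms(1) by (simp add: is_haar_SO_def)
  also have "\<dots> = (\<integral>\<^sup>+A. h (B ** A) \<partial>\<mu>)"
    using assms by (intro nn_integral_distr left_mult_measurable) simp_all
  finally show ?thesis ..
qed

text \<open>Only left invariance is assumed. It makes the law of \<open>A\<^sup>T z\<close> independent of \<open>z\<close>, and averaging
  the identity \<open>law(B p) = law(A\<^sup>T B p)\<close> over \<open>A\<close> shows that it is also the law of \<open>B p\<close>.\<close>

lemma nn_integral_orbit_aux:
  assumes h[measurable]: "h \<in> borel_measurable sphere_borel"
    and z: "z \<in> unit_sphere" and p: "p \<in> unit_sphere"
  shows "(\<integral>\<^sup>+A. h (transpose A *v z) \<partial>\<mu>) = (\<integral>\<^sup>+A. h (A *v p) \<partial>\<mu>)"
proof -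
  have hm: "(\<lambda>x. h (f x)) \<in> borel_measurable M"
    if "f \<in> measurable M sphere_borel" for f and M :: "'z measure"
    using that h by (rule measurable_compose)
  define J where "J = (\<lambda>z. \<integral>\<^sup>+A. h (transpose A *v z) \<partial>\<mu>)"
  have J: "J x = J y" if xy: "x \<in> unit_sphere" "y \<in> unit_sphere" for x y
  proof -
    obtain B where B: "B \<in> SO" "B *v x = y" using SO_transitive[OF card2 xy] .
    \<comment> \<open>Left translation by \<open>transpose B\<close> turns
      \<open>transpose A\<close> into \<open>transpose A ** B\<close>, so it acts on the base
      point.\<close>
    have "J x = (\<integral>\<^sup>+A. h (transpose (transpose B ** A) *v x) \<partial>\<mu>)"
      unfolding J_def using B(1)
      by (intro nn_integral_left_mult[symmetric] hm orbit_transpose_measurable xy SO_transpose)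
    also have "\<dots> = J y"
      unfolding J_def by (simp add: matrix_transpose_mul B(2)[symmetric] matrix_vector_mul_assoc)
    finally show ?thesis .
  qed
  interpret P: pair_sigma_finite \<mu> \<mu> ..
  have m2: "(\<lambda>(A, B). transpose A *v (B *v p)) \<in> measurable (\<mu> \<Otimes>\<^sub>M \<mu>) sphere_borel"
  proof (rule measurable_sphere_borelI)
    have [measurable]: "fst \<in> borel_measurable (\<mu> \<Otimes>\<^sub>M \<mu>)" "snd \<in> borel_measurable (\<mu> \<Otimes>\<^sub>M \<mu>)"
      by (auto intro: measurable_haarD)
    show "(\<lambda>(A, B). transpose A *v (B *v p)) \<in> borel_measurable (\<mu> \<Otimes>\<^sub>M \<mu>)"
      unfolding split_def by measurable
  qed (use p in \<open>auto simp: space_pair_measure intro!: SO_sphere[simplified] SO_transpose[simplified]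
        simp: norm_SO SO_transpose[simplified]\<close>)
  have "(\<integral>\<^sup>+B. h (B *v p) \<partial>\<mu>) = (\<integral>\<^sup>+A. (\<integral>\<^sup>+B. h (B *v p) \<partial>\<mu>) \<partial>\<mu>)"
    by (simp add: emeasure_space_1[simplified])
  also have "\<dots> = (\<integral>\<^sup>+A. (\<integral>\<^sup>+B. h (transpose A *v (B *v p)) \<partial>\<mu>) \<partial>\<mu>)"
  proof (rule nn_integral_cong)
    fix A assume A: "A \<in> space \<mu>"
    have "(\<integral>\<^sup>+B. h (B *v p) \<partial>\<mu>) = (\<integral>\<^sup>+B. h ((transpose A ** B) *v p) \<partial>\<mu>)"
      using A p by (intro nn_integral_left_mult[symmetric] SO_transpose hm orbit_measurable) auto
    then show "(\<integral>\<^sup>+B. h (B *v p) \<partial>\<mu>) = (\<integral>\<^sup>+B. h (transpose A *v (B *v p)) \<partial>\<mu>)"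
      by (simp add: matrix_vector_mul_assoc)
  qed
  also have "\<dots> = (\<integral>\<^sup>+B. J (B *v p) \<partial>\<mu>)"
    unfolding J_def using hm[OF m2] by (intro P.Fubini'[symmetric]) (simp add: split_def)
  also have "\<dots> = (\<integral>\<^sup>+B. J z \<partial>\<mu>)"
    using p z by (intro nn_integral_cong J) (auto simp: norm_SO)
  finally show ?thesis by (simp add: emeasure_space_1[simplified] J_def)
qed

section \<open>The rotation-invariant measure on the sphere\<close>

lemma sets_sphere_measure [measurable_cong]: "sets \<sigma> = sets sphere_borel"
  by (simp add: sphere_measure_def)

lemma space_sphere_measure [simp]: "space \<sigma> = unit_sphere"
  by (simp add: sphere_measure_def)

lemma some_in_sphere: "(SOME p. p \<in> (unit_sphere :: (real^'n) set)) \<in> unit_sphere"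
  by (rule someI_ex) (use vector_choose_size[of 1] in auto)

lemma nn_integral_sphere:
  assumes h: "h \<in> borel_measurable sphere_borel"
  shows "(\<integral>\<^sup>+x. h x \<partial>\<sigma>) = (\<integral>\<^sup>+A. h (A *v (SOME p. p \<in> unit_sphere)) \<partial>\<mu>)"
  unfolding sphere_measure_def
  using h by (intro nn_integral_distr orbit_measurable some_in_sphere) simp

lemma distr_eq_sphereI:
  assumes f: "f \<in> measurable M sphere_borel"
    and "\<And>h :: real^'n \<Rightarrow> ennreal. h \<in> borel_measurable sphere_borel \<Longrightarrow>
      (\<integral>\<^sup>+x. h (f x) \<partial>M) = (\<integral>\<^sup>+x. h x \<partial>\<sigma>)"
  shows "distr M sphere_borel f = \<sigma>"
proof (rule measure_eqI)
  fix X assume "X \<in> sets (distr M sphere_borel f)"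
  then have X: "X \<in> sets sphere_borel" by simp
  then have "emeasure (distr M sphere_borel f) X = (\<integral>\<^sup>+x. indicator X x \<partial>distr M sphere_borel f)"
    by simp
  also have "\<dots> = (\<integral>\<^sup>+x. indicator X (f x) \<partial>M)"
    using f X by (intro nn_integral_distr) auto
  also have "\<dots> = emeasure \<sigma> X"
    using X by (subst assms(2)) (auto simp: sets_sphere_measure)
  finally show "emeasure (distr M sphere_borel f) X = emeasure \<sigma> X" .
qed (simp add: sets_sphere_measure)

lemma distr_orbit: "z \<in> unit_sphere \<Longrightarrow> distr \<mu> sphere_borel (\<lambda>A. A *v z) = \<sigma>"
  using some_in_sphere
  by (intro distr_eq_sphereI orbit_measurable)
     (auto simp: nn_integral_sphere nn_integral_orbit_aux[symmetric, of _ "SOME p. p \<in> unit_sphere"])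

lemma distr_orbit_transpose: "z \<in> unit_sphere \<Longrightarrow> distr \<mu> sphere_borel (\<lambda>A. transpose A *v z) = \<sigma>"
  by (intro distr_eq_sphereI orbit_transpose_measurable)
     (simp_all only: nn_integral_sphere nn_integral_orbit_aux[OF _ _ some_in_sphere])

lemma distr_rotate:
  assumes B: "B \<in> SO"
  shows "distr \<sigma> sphere_borel (\<lambda>x. B *v x) = \<sigma>"
proof -
  have m: "(\<lambda>x. B *v x) \<in> measurable sphere_borel sphere_borel"
    using B by (intro measurable_sphere_borelI measurable_restrict_space1) (auto simp: norm_SO)
  let ?p = "SOME p. p \<in> (unit_sphere :: (real^'n) set)"
  have "distr \<sigma> sphere_borel (\<lambda>x. B *v x) = distr \<mu> sphere_borel (\<lambda>A. B *v (A *v ?p))"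
    unfolding sphere_measure_def using m orbit_measurable[OF some_in_sphere]
    by (subst distr_distr) (auto simp: comp_def)
  also have "\<dots> = \<sigma>"
  proof (rule distr_eq_sphereI)
    show "(\<lambda>A. B *v (A *v ?p)) \<in> measurable \<mu> sphere_borel"
      using orbit_measurable[OF some_in_sphere] m by (rule measurable_compose)
    fix h :: "real^'n \<Rightarrow> ennreal" assume h: "h \<in> borel_measurable sphere_borel"
    show "(\<integral>\<^sup>+A. h (B *v (A *v ?p)) \<partial>\<mu>) = (\<integral>\<^sup>+x. h x \<partial>\<sigma>)"
      unfolding nn_integral_sphere[OF h] matrix_vector_mul_assoc
      by (rule nn_integral_left_mult[OF B, of "\<lambda>A. h (A *v ?p)"])
         (rule measurable_compose[OF orbit_measurable[OF some_in_sphere] h])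
  qed
  finally show ?thesis .
qed

lemma prob_space_sphere: "prob_space \<sigma>"
  unfolding sphere_measure_def by (rule prob_space_distr[OF orbit_measurable[OF some_in_sphere]])

end

section \<open>Moments of kernels averaged over random words\<close>

lemma word_product_Nil [simp]: "word_product S [] = mat 1"
  by (simp add: word_product_def)

lemma word_product_Cons [simp]: "word_product S (a # w) = letter S a ** word_product S w"
  by (simp add: word_product_def)

lemma word_product_fun_upd: "a \<notin> fst ` set w \<Longrightarrow> word_product (S(a := s)) w = word_product S w"
  by (induction w) (auto simp: letter_def split: prod.splits)

lemma letter_SO: "S (fst a) \<in> SO \<Longrightarrow> letter S a \<in> SO"
  using SO_transpose[of "S (fst a)"] by (auto simp: letter_def matrix_inv_SO split: prod.splits)

lemma word_product_SO: "(\<And>i. i \<in> fst ` set w \<Longrightarrow> S i \<in> SO) \<Longrightarrow> word_product S w \<in> SO"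
proof (induction w)
  case Nil
  then show ?case by (simp add: rotation_matrix_def orthogonal_matrix_id)
next
  case (Cons a w)
  then show ?case
    using SO_mult[OF letter_SO[of S a], of "word_product S w"] by simp
qed

lemma word_point_sphere:
  "(\<And>i. i \<in> fst ` set w \<Longrightarrow> S i \<in> SO) \<Longrightarrow> x \<in> unit_sphere \<Longrightarrow> word_product S w *v x \<in> unit_sphere"
  by (intro SO_sphere word_product_SO)

text \<open>One monomial of the expanded p-th power. Its 2p words of length l are concatenated into
  one word, so that the occurrences of an index are counted across all factors at once.\<close>

primrec block_prod ::
  "(real^'n \<Rightarrow> real^'n \<Rightarrow> real) \<Rightarrow> nat \<Rightarrow> real^'n \<Rightarrow> (nat \<Rightarrow> real^'n^'n) \<Rightarrow> nat \<Rightarrow> (nat \<times> bool) list \<Rightarrow> real"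
where
  "block_prod K l x S 0 w = 1"
| "block_prod K l x S (Suc p) w =
     K (word_product S (take l w) *v x) (word_product S (take l (drop l w)) *v x) *
     block_prod K l x S p (drop l (drop l w))"

lemma power_sum_block_prod:
  "(\<Sum>u\<in>words k l. \<Sum>v\<in>words k l. K (word_product S u *v x) (word_product S v *v x)) ^ p
    = (\<Sum>w\<in>words k (2 * l * p). block_prod K l x S p w)"
proof (induction p)
  case 0
  show ?case by (simp add: words_0)
next
  case (Suc p)
  have "(\<Sum>w\<in>words k (2 * l * Suc p). block_prod K l x S (Suc p) w)
      = (\<Sum>w\<in>words k (l + (l + 2 * l * p)). block_prod K l x S (Suc p) w)"
    by (simp add: algebra_simps)
  also have "\<dots> = (\<Sum>u\<in>words k l. \<Sum>v\<in>words k l. \<Sum>w\<in>words k (2 * l * p).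
      block_prod K l x S (Suc p) (u @ v @ w))"
    by (simp only: sum_words_add)
  also have "\<dots> = (\<Sum>u\<in>words k l. \<Sum>v\<in>words k l. \<Sum>w\<in>words k (2 * l * p).
      K (word_product S u *v x) (word_product S v *v x) * block_prod K l x S p w)"
    by (intro sum.cong refl) (simp add: words_def)
  finally show ?case
    by (simp add: Suc[symmetric] sum_distrib_left[symmetric] sum_distrib_right[symmetric])
qed

context haar_SO
begin

lemma prob_space_haar_power: "prob_space (\<Pi>\<^sub>M i\<in>I. \<mu>)"
  by (intro prob_space_PiM) unfold_locales

text \<open>This is where the law of \<open>transpose A *v z\<close> is used: a random inverse
  letter also sends a fixed point to a \<sigma>-distributed one.\<close>

lemma random_letter:
  assumes "z \<in> unit_sphere"
  shows "(\<lambda>s. letter (S(a := s)) (a, b) *v z) \<in> measurable \<mu> sphere_borel" (is ?m)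
    and "distr \<mu> sphere_borel (\<lambda>s. letter (S(a := s)) (a, b) *v z) = \<sigma>" (is ?d)
proof -
  have eq: "letter (S(a := s)) (a, b) *v z = (if b then s else transpose s) *v z" if "s \<in> space \<mu>" for s
    using that by (simp add: letter_def matrix_inv_SO)
  show ?m
    using orbit_measurable[OF assms] orbit_transpose_measurable[OF assms]
    by (subst measurable_cong[OF eq]) (cases b; simp)+
  show ?d
    using distr_orbit[OF assms] distr_orbit_transpose[OF assms]
    by (subst distr_cong[OF refl refl eq]) (cases b; simp)+
qed

text \<open>The letters to the right of the single occurrence produce a fixed point of the sphere,
  the random letter makes it \<sigma>-distributed, and the letters to its left are fixed rotations,
  which preserve \<sigma>.\<close>

lemma random_word:
  assumes single: "count_list (map fst w) a = 1"
    and S: "\<And>i. i \<in> fst ` set w - {a} \<Longrightarrow> S i \<in> SO"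
    and x: "x \<in> unit_sphere"
  shows "(\<lambda>s. word_product (S(a := s)) w *v x) \<in> measurable \<mu> sphere_borel" (is ?m)
    and "distr \<mu> sphere_borel (\<lambda>s. word_product (S(a := s)) w *v x) = \<sigma>" (is ?d)
proof -
  have "?m \<and> ?d" using single S
  proof (induction w)
    case (Cons c w)
    show ?case
    proof (cases "fst c = a")
      case True
      then obtain b where c: "c = (a, b)" by (cases c) auto
      have a: "a \<notin> fst ` set w"
        using Cons.prems(1) True by (simp add: count_list_0_iff)
      have y: "word_product S w *v x \<in> unit_sphere"
        using a Cons.prems(2) x by (intro word_point_sphere) auto
      have "word_product (S(a := s)) (c # w) *v x = letter (S(a := s)) (a, b) *v (word_product S w *v x)" for s
        by (simp add: c word_product_fun_upd[OF a] matrix_vector_mul_assoc)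
      with random_letter[OF y, of S a b] show ?thesis by (simp only: simp_thms)
    next
      case False
      have B: "letter S c \<in> SO"
        using Cons.prems(2) False by (intro letter_SO) auto
      have eq: "letter (S(a := s)) c = letter S c" for s
        using False by (cases c) (auto simp: letter_def)
      have IH: "(\<lambda>s. word_product (S(a := s)) w *v x) \<in> measurable \<mu> sphere_borel"
          "distr \<mu> sphere_borel (\<lambda>s. word_product (S(a := s)) w *v x) = \<sigma>"
        using Cons False by (auto simp del: fun_upd_apply)
      have mB: "(\<lambda>y. letter S c *v y) \<in> measurable sphere_borel sphere_borel"
        using B by (intro measurable_sphere_borelI measurable_restrict_space1) (auto simp: norm_SO)
      have "distr \<mu> sphere_borel (\<lambda>s. letter S c *v (word_product (S(a := s)) w *v x))
          = distr (distr \<mu> sphere_borel (\<lambda>s. word_product (S(a := s)) w *v x)) sphere_borel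
              (\<lambda>y. letter S c *v y)"
        using IH(1) mB by (simp add: distr_distr comp_def)
      also have "\<dots> = \<sigma>" unfolding IH(2) by (rule distr_rotate[OF B])
      finally show ?thesis
        using measurable_compose[OF IH(1) mB]
        by (simp add: eq matrix_vector_mul_assoc del: fun_upd_apply)
    qed
  qed simp
  then show ?m ?d by auto
qed

lemma measurable_word_product:
  assumes w: "w \<in> words k l" and x: "x \<in> unit_sphere"
  shows "(\<lambda>S. word_product S w *v x) \<in> measurable (\<Pi>\<^sub>M i\<in>{..<k}. \<mu>) sphere_borel"
  using w
proof (induction w arbitrary: l)
  case Nil
  then show ?case using x by simp
next
  case (Cons c w)
  obtain i b where c: "c = (i, b)" by (cases c)
  have i: "i < k" and w: "w \<in> words k (l - 1)" using Cons.prems by (auto simp: c words_def)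
  let ?P = "\<Pi>\<^sub>M i\<in>{..<k}. \<mu>"
  have S: "S i \<in> SO" if "S \<in> space ?P" for S
    using that i by (auto simp: space_PiM)
  have eq: "word_product S (c # w) *v x
      = (if b then S i else transpose (S i)) *v (word_product S w *v x)" if "S \<in> space ?P" for S
    using S[OF that] by (simp add: c letter_def matrix_inv_SO matrix_vector_mul_assoc)
  have [measurable]: "(\<lambda>S. S i) \<in> borel_measurable ?P"
    using i by (intro measurable_haarD measurable_component_singleton) auto
  note IH = Cons.IH[OF w]
  note [measurable] = measurable_sphere_borelD[OF IH]
  show ?case
  proof (subst measurable_cong[OF eq], assumption, rule measurable_sphere_borelI)
    show "(\<lambda>S. (if b then S i else transpose (S i)) *v (word_product S w *v x)) \<in> borel_measurable ?P"
      by (cases b) simp_all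
    show "(if b then S i else transpose (S i)) *v (word_product S w *v x) \<in> unit_sphere"
      if "S \<in> space ?P" for S
      using S[OF that] measurable_space[OF IH that] SO_transpose[of "S i"] by (auto simp: norm_SO)
  qed
qed

end

text \<open>The mean is required to vanish in each variable because the index that occurs once may
  lie in either word of a pair.\<close>

locale word_kernel = haar_SO \<mu> for \<mu> :: "(real^'n^'n) measure" +
  fixes K :: "real^'n \<Rightarrow> real^'n \<Rightarrow> real" and b :: real and x0 :: "real^'n"
  assumes K_measurable: "case_prod K \<in> borel_measurable (sphere_borel \<Otimes>\<^sub>M sphere_borel)"
    and K_bound: "\<And>x y. x \<in> unit_sphere \<Longrightarrow> y \<in> unit_sphere \<Longrightarrow> \<bar>K x y\<bar> \<le> b"
    and K_left: "\<And>y. y \<in> unit_sphere \<Longrightarrow> (\<integral>x. K x y \<partial>\<sigma>) = 0"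
    and K_right: "\<And>x. x \<in> unit_sphere \<Longrightarrow> (\<integral>y. K x y \<partial>\<sigma>) = 0"
    and x0: "x0 \<in> unit_sphere"
begin

lemma measurable_K:
  "f \<in> measurable M sphere_borel \<Longrightarrow> g \<in> measurable M sphere_borel \<Longrightarrow> (\<lambda>x. K (f x) (g x)) \<in> borel_measurable M"
  using measurable_compose[OF measurable_Pair K_measurable, of f M g] by simp

text \<open>Exactly one of the first word, the second word and the rest contains \<open>a\<close>;
  everything else is constant in \<open>s\<close>. In the first two cases the kernel factor
  integrates to 0 by \<open>random_word\<close> and the mean-zero condition, in the third the
  induction hypothesis applies.\<close>

lemma integral_block_prod_single:
  assumes "count_list (map fst w) a = 1"
    and "\<And>i. i \<in> fst ` set w - {a} \<Longrightarrow> S i \<in> SO" and "length w = 2 * l * p"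
  shows "(\<integral>s. block_prod K l x0 (S(a := s)) p w \<partial>\<mu>) = 0"
  using assms
proof (induction p arbitrary: w)
  case 0
  then show ?case by simp
next
  case (Suc p)
  define u v w' where "u = take l w" and "v = take l (drop l w)" and "w' = drop l (drop l w)"
  have w: "w = u @ v @ w'"
    by (simp only: u_def v_def w'_def append_take_drop_id)
  let ?W = "\<lambda>s u. word_product (S(a := s)) u *v x0"
  have step: "block_prod K l x0 (S(a := s)) (Suc p) w
      = K (?W s u) (?W s v) * block_prod K l x0 (S(a := s)) p w'" for s
    by (simp add: u_def v_def w'_def)
  have const_bp: "block_prod K l x0 (S(a := s)) p z = block_prod K l x0 S p z"
    if "a \<notin> fst ` set z" for s p z
    using that
  proof (induction p arbitrary: z)
    case (Suc p)
    have z: "a \<notin> fst ` set (take l z)" "a \<notin> fst ` set (take l (drop l z))"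
        "a \<notin> fst ` set (drop l (drop l z))"
      using Suc.prems by (auto dest: in_set_takeD in_set_dropD)
    show ?case
      by (simp only: block_prod.simps Suc.IH[OF z(3)] word_product_fun_upd[OF z(1)]
          word_product_fun_upd[OF z(2)])
  qed simp
  have SO': "word_product S z *v x0 \<in> unit_sphere"
    if "set z \<subseteq> set w" "a \<notin> fst ` set z" for z
    using that Suc.prems(2) x0 by (intro word_point_sphere) blast+
  have count: "count_list (map fst u) a + count_list (map fst v) a + count_list (map fst w') a = 1"
    using Suc.prems(1) by (simp add: w)
  have notin: "a \<notin> fst ` set z" if "count_list (map fst z) a = 0" for z :: "(nat \<times> bool) list"
    using that by (simp add: count_list_0_iff)
  consider "count_list (map fst u) a = 1" "count_list (map fst v) a = 0" "count_list (map fst w') a = 0"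
    | "count_list (map fst u) a = 0" "count_list (map fst v) a = 1" "count_list (map fst w') a = 0"
    | "count_list (map fst u) a = 0" "count_list (map fst v) a = 0" "count_list (map fst w') a = 1"
    using count by linarith
  then show ?case
  proof cases
    case 1
    have y: "word_product S v *v x0 \<in> unit_sphere" using 1 by (intro SO' notin) (auto simp: w)
    note rw = random_word[OF 1(1), of S x0]
    have rw1: "(\<lambda>s. ?W s u) \<in> measurable \<mu> sphere_borel" and rw2: "distr \<mu> sphere_borel (\<lambda>s. ?W s u) = \<sigma>"
      using x0 Suc.prems(2) by (auto intro!: rw simp: w)
    have "(\<integral>s. K (?W s u) (word_product S v *v x0) \<partial>\<mu>)
        = (\<integral>x. K x (word_product S v *v x0) \<partial>distr \<mu> sphere_borel (\<lambda>s. ?W s u))"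
      using rw1 y by (intro integral_distr[symmetric] measurable_K) auto
    also have "\<dots> = 0" using K_left[OF y] by (simp add: rw2)
    finally have 0: "(\<integral>s. K (?W s u) (word_product S v *v x0) \<partial>\<mu>) = 0" .
    have "block_prod K l x0 (S(a := s)) (Suc p) w
        = K (?W s u) (word_product S v *v x0) * block_prod K l x0 S p w'" for s
      by (simp only: step const_bp[OF notin[OF 1(3)]] word_product_fun_upd[OF notin[OF 1(2)]])
    then show ?thesis
      by (simp only: integral_mult_left_zero 0 mult_zero_left)
  next
    case 2
    have y: "word_product S u *v x0 \<in> unit_sphere" using 2 by (intro SO' notin) (auto simp: w)
    note rw = random_word[OF 2(2), of S x0]
    have rw1: "(\<lambda>s. ?W s v) \<in> measurable \<mu> sphere_borel" and rw2: "distr \<mu> sphere_borel (\<lambda>s. ?W s v) = \<sigma>"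
      using x0 Suc.prems(2) by (auto intro!: rw simp: w)
    have "(\<integral>s. K (word_product S u *v x0) (?W s v) \<partial>\<mu>)
        = (\<integral>x. K (word_product S u *v x0) x \<partial>distr \<mu> sphere_borel (\<lambda>s. ?W s v))"
      using rw1 y by (intro integral_distr[symmetric] measurable_K) auto
    also have "\<dots> = 0" using K_right[OF y] by (simp add: rw2)
    finally have 0: "(\<integral>s. K (word_product S u *v x0) (?W s v) \<partial>\<mu>) = 0" .
    have "block_prod K l x0 (S(a := s)) (Suc p) w
        = K (word_product S u *v x0) (?W s v) * block_prod K l x0 S p w'" for s
      by (simp only: step const_bp[OF notin[OF 2(3)]] word_product_fun_upd[OF notin[OF 2(1)]])
    then show ?thesis
      by (simp only: integral_mult_left_zero 0 mult_zero_left)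
  next
    case 3
    have "(\<integral>s. block_prod K l x0 (S(a := s)) p w' \<partial>\<mu>) = 0"
      using 3 Suc.prems by (intro Suc.IH) (auto simp: w'_def dest: in_set_dropD)
    then show ?thesis
      by (simp only: step integral_mult_right_zero mult_zero_right
          word_product_fun_upd[OF notin[OF 3(1)]] word_product_fun_upd[OF notin[OF 3(2)]])
  qed
qed

lemma b_nonneg: "b \<ge> 0"
  using K_bound[OF x0 x0] by linarith

lemma block_prod_bound:
  assumes "\<And>i. i \<in> fst ` set w \<Longrightarrow> S i \<in> SO"
  shows "\<bar>block_prod K l x0 S p w\<bar> \<le> b ^ p"
  using assms
proof (induction p arbitrary: w)
  case (Suc p)
  have "\<bar>K (word_product S (take l w) *v x0) (word_product S (take l (drop l w)) *v x0)\<bar> \<le> b"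
    using Suc.prems x0 by (intro K_bound word_point_sphere) (auto dest: in_set_takeD in_set_dropD)
  moreover have "\<bar>block_prod K l x0 S p (drop l (drop l w))\<bar> \<le> b ^ p"
    using Suc.prems by (intro Suc.IH) (auto dest: in_set_dropD)
  ultimately show ?case
    by (simp add: abs_mult mult_mono b_nonneg)
qed simp

lemma take_drop_words: "w \<in> words k m \<Longrightarrow> take i w \<in> words k (min m i)" "w \<in> words k m \<Longrightarrow> drop i w \<in> words k (m - i)"
  by (auto simp: words_def dest: in_set_takeD in_set_dropD)

lemma measurable_block_prod:
  "w \<in> words k m \<Longrightarrow>
    (\<lambda>S. block_prod K l x0 S p w) \<in> borel_measurable (\<Pi>\<^sub>M i\<in>{..<k}. \<mu>)"
proof (induction p arbitrary: w m)
  case (Suc p)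
  show ?case
    unfolding block_prod.simps
    using Suc.prems x0
    by (intro borel_measurable_times measurable_K measurable_word_product Suc.IH)
       (rule take_drop_words | assumption)+
qed simp

text \<open>Each monomial is at most b^p in modulus, and Fubini with the coordinate of a single
  index integrated first kills every monomial that has one.\<close>

lemma moment_bound:
  "(\<integral>S. (\<Sum>u\<in>words k l. \<Sum>v\<in>words k l. K (word_product S u *v x0) (word_product S v *v x0)) ^ p
      \<partial>(\<Pi>\<^sub>M i\<in>{..<k}. \<mu>))
    \<le> b ^ p * card {w \<in> words k (2 * l * p). \<forall>i. count_list (map fst w) i \<noteq> 1}"
proof -
  let ?P = "\<Pi>\<^sub>M i\<in>{..<k}. \<mu>" and ?N = "2 * l * p"
  interpret P: prob_space ?P by (rule prob_space_haar_power)
  interpret F: product_sigma_finite "\<lambda>i::nat. \<mu>" ..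
  have idx: "i < k" if "w \<in> words k m" "i \<in> fst ` set w" for w m i
    using that unfolding words_def by force
  have S_SO: "S i \<in> SO" if "S \<in> space ?P" "w \<in> words k ?N" "i \<in> fst ` set w" for S w i
    using that(1) idx[OF that(2,3)] PiE_mem[of S "{..<k}" "\<lambda>_. SO" i] by (simp add: space_PiM)
  have bnd: "\<bar>block_prod K l x0 S p w\<bar> \<le> b ^ p" if "S \<in> space ?P" "w \<in> words k ?N" for S w
    using S_SO[OF that] by (intro block_prod_bound)
  have int: "integrable ?P (\<lambda>S. block_prod K l x0 S p w)" if "w \<in> words k ?N" for w
    using that bnd by (intro P.integrable_const_bound[where B = "b ^ p"] measurable_block_prod) auto
  have le: "(\<integral>S. block_prod K l x0 S p w \<partial>?P) \<le> b ^ p" if "w \<in> words k ?N" for w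
    using P.integral_le_const[OF int[OF that], of "b ^ p"] bnd[OF _ that] by (auto simp: abs_le_iff)
  have zero: "(\<integral>S. block_prod K l x0 S p w \<partial>?P) = 0"
    if w: "w \<in> words k ?N" and a: "count_list (map fst w) a = 1" for w a
  proof -
    have "a \<in> fst ` set w" using a count_list_0_iff[of "map fst w" a] by auto
    then have ak: "a < k" by (rule idx[OF w])
    then have ins: "{..<k} = insert a ({..<k} - {a})" by auto
    have "(\<integral>S. block_prod K l x0 S p w \<partial>?P)
        = (\<integral>S. (\<integral>s. block_prod K l x0 (S(a := s)) p w \<partial>\<mu>) \<partial>(\<Pi>\<^sub>M i\<in>{..<k} - {a}. \<mu>))"
      using int[OF w] by (subst ins, intro F.product_integral_insert) (simp_all add: insert_absorb ak)
    also have "\<dots> = (\<integral>S. 0 \<partial>(\<Pi>\<^sub>M i\<in>{..<k} - {a}. \<mu>))"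
    proof (intro Bochner_Integration.integral_cong refl integral_block_prod_single a)
      fix S i assume "S \<in> space (\<Pi>\<^sub>M i\<in>{..<k} - {a}. \<mu>)" "i \<in> fst ` set w - {a}"
      then show "S i \<in> SO"
        using idx[OF w, of i] PiE_mem[of S "{..<k} - {a}" "\<lambda>_. SO" i] by (simp add: space_PiM)
    qed (use w in \<open>simp add: words_def\<close>)
    finally show ?thesis by simp
  qed
  have "(\<integral>S. (\<Sum>u\<in>words k l. \<Sum>v\<in>words k l. K (word_product S u *v x0) (word_product S v *v x0)) ^ p \<partial>?P)
      = (\<Sum>w\<in>words k ?N. \<integral>S. block_prod K l x0 S p w \<partial>?P)"
    unfolding power_sum_block_prod using int by (rule Bochner_Integration.integral_sum)
  also have "\<dots> \<le> (\<Sum>w\<in>words k ?N. if \<forall>i. count_list (map fst w) i \<noteq> 1 then b ^ p else 0)"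
    using zero le by (intro sum_mono) auto
  also have "\<dots> = b ^ p * card {w \<in> words k ?N. \<forall>i. count_list (map fst w) i \<noteq> 1}"
    by (simp add: sum.If_cases finite_words Int_def)
  finally show ?thesis .
qed

end

section \<open>Wasserstein distance to empirical measures\<close>

text \<open>Averaging over an index set rather than over a set of points counts repeated points with
  multiplicity, as the orbit measure requires.\<close>

definition empirical :: "'w set \<Rightarrow> ('w \<Rightarrow> 'a::euclidean_space) \<Rightarrow> 'a measure" where
  "empirical W q = distr (uniform_count_measure W) sphere_borel q"

lemma sets_empirical [measurable_cong, simp]: "sets (empirical W q) = sets sphere_borel"
  by (simp add: empirical_def)

locale empirical_points = prob_space \<sigma> for \<sigma> :: "('a::euclidean_space) measure" +
  fixes W :: "'w set"
  assumes sets_\<sigma> [measurable_cong]: "sets \<sigma> = sets sphere_borel"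
    and W: "finite W" "W \<noteq> {}"
begin

lemma space_\<sigma> [simp]: "space \<sigma> = unit_sphere"
  using sets_eq_imp_space_eq[OF sets_\<sigma>] by simp

lemma card_W_pos: "card W > 0"
  using W by (simp add: card_gt_0_iff)

lemma measurable_points:
  "q \<in> W \<rightarrow> unit_sphere \<Longrightarrow> q \<in> measurable (uniform_count_measure W) sphere_borel"
  by (auto simp: measurable_def space_uniform_count_measure sets_uniform_count_measure)

lemma emeasure_empirical:
  assumes "q \<in> W \<rightarrow> unit_sphere" "A \<in> sets sphere_borel"
  shows "emeasure (empirical W q) A = ennreal (card {w \<in> W. q w \<in> A} / card W)"
proof -
  have "emeasure (empirical W q) A = emeasure (uniform_count_measure W) {w \<in> W. q w \<in> A}"
    unfolding empirical_def using assms
    by (subst emeasure_distr[OF measurable_points])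
       (auto simp: space_uniform_count_measure intro!: arg_cong2[where f = emeasure])
  then show ?thesis using W by (simp add: emeasure_uniform_count_measure)
qed

text \<open>Since the second marginal is finitely supported, a coupling is a family \<open>h w\<close> of densities:
  \<open>h w b\<close> is the fraction of the mass at \<open>b\<close> that is sent to \<open>q w\<close>.\<close>

lemma wasserstein1_le_assignment:
  assumes q: "q \<in> W \<rightarrow> unit_sphere" and B: "prob_space B"
    and \<phi>[measurable]: "\<phi> \<in> measurable B sphere_borel" and dB: "distr B sphere_borel \<phi> = \<sigma>"
    and h[measurable]: "\<And>w. w \<in> W \<Longrightarrow> h w \<in> borel_measurable B"
    and row: "AE b in B. (\<Sum>w\<in>W. h w b) = 1"
    and col: "\<And>w. w \<in> W \<Longrightarrow> (\<integral>\<^sup>+b. h w b \<partial>B) = ennreal (1 / card W)"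
  shows "wasserstein1 \<sigma> (empirical W q)
    \<le> (\<Sum>w\<in>W. \<integral>\<^sup>+b. h w b * ennreal (dist (\<phi> b) (q w)) \<partial>B)"
proof -
  interpret B: prob_space B by (rule B)
  \<comment> \<open>The abstract source \<open>B\<close> with its map \<phi> serves two situations:
    \<sigma> with the identity, and an existing coupling with its first projection.\<close>
  let ?\<nu> = "empirical W q" and ?C = "count_space W"
  define D where "D = density (?C \<Otimes>\<^sub>M B) (\<lambda>(w, b). h w b)"
  define \<pi> where "\<pi> = distr D (sphere_borel \<Otimes>\<^sub>M sphere_borel) (\<lambda>(w, b). (\<phi> b, q w))"
  have hm: "(\<lambda>(w, b). h w b) \<in> borel_measurable (?C \<Otimes>\<^sub>M B)"
    using W by (intro measurable_pair_measure_countable1) (auto intro: countable_finite)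
  have Tm: "(\<lambda>(w, b). (\<phi> b, q w)) \<in> measurable (?C \<Otimes>\<^sub>M B) (sphere_borel \<Otimes>\<^sub>M sphere_borel)"
  proof (rule measurable_pair_measure_countable1)
    fix w assume "w \<in> W"
    with q have "q w \<in> space sphere_borel" by auto
    then show "(\<lambda>b. case (w, b) of (w, b) \<Rightarrow> (\<phi> b, q w)) \<in> measurable B (sphere_borel \<Otimes>\<^sub>M sphere_borel)"
      by simp
  qed (use W in \<open>simp add: countable_finite\<close>)
  \<comment> \<open>Both marginals and the transport cost are read off from this formula.\<close>
  have key: "(\<integral>\<^sup>+p. g p \<partial>\<pi>) = (\<Sum>w\<in>W. \<integral>\<^sup>+b. h w b * g (\<phi> b, q w) \<partial>B)"
    if g: "g \<in> borel_measurable (sphere_borel \<Otimes>\<^sub>M sphere_borel)" for g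
  proof -
    have gT: "(\<lambda>x. g (case x of (w, b) \<Rightarrow> (\<phi> b, q w))) \<in> borel_measurable (?C \<Otimes>\<^sub>M B)"
      using Tm g by (rule measurable_compose)
    have "(\<integral>\<^sup>+p. g p \<partial>\<pi>) = (\<integral>\<^sup>+x. g (case x of (w, b) \<Rightarrow> (\<phi> b, q w)) \<partial>D)"
      unfolding \<pi>_def using Tm g by (intro nn_integral_distr) (auto simp: D_def)
    also have "\<dots> = (\<integral>\<^sup>+x. (case x of (w, b) \<Rightarrow> h w b) * g (case x of (w, b) \<Rightarrow> (\<phi> b, q w)) \<partial>(?C \<Otimes>\<^sub>M B))"
      unfolding D_def using hm gT by (intro nn_integral_density)
    also have "\<dots> = (\<integral>\<^sup>+w. \<integral>\<^sup>+b. h w b * g (\<phi> b, q w) \<partial>B \<partial>?C)"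
      using hm gT by (subst B.nn_integral_fst[symmetric]) auto
    finally show ?thesis using W by (simp add: nn_integral_count_space_finite)
  qed
  have ind: "emeasure \<pi> A = (\<Sum>w\<in>W. \<integral>\<^sup>+b. h w b * indicator A (\<phi> b, q w) \<partial>B)"
    if "A \<in> sets (sphere_borel \<Otimes>\<^sub>M sphere_borel)" for A
    using key[of "indicator A"] that by (simp add: \<pi>_def)
  have sets_eq: "sets (\<sigma> \<Otimes>\<^sub>M ?\<nu>) = sets (sphere_borel \<Otimes>\<^sub>M sphere_borel)"
    by (intro sets_pair_measure_cong sets_\<sigma>) simp
  have sets_\<pi>: "sets \<pi> = sets (sphere_borel \<Otimes>\<^sub>M sphere_borel)"
    by (simp add: \<pi>_def)
  have space_\<pi>: "space \<pi> = unit_sphere \<times> unit_sphere"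
    by (simp add: \<pi>_def space_pair_measure)
  have \<phi>_sphere: "\<phi> b \<in> unit_sphere" if "b \<in> space B" for b
    using measurable_space[OF \<phi> that] by simp
  have "\<pi> \<in> couplings \<sigma> ?\<nu>"
    unfolding couplings_def
  proof (intro CollectI conjI)
    have fst_m: "fst \<in> measurable \<pi> \<sigma>" and snd_m: "snd \<in> measurable \<pi> ?\<nu>"
      by (auto simp: measurable_cong_sets[OF sets_\<pi> sets_\<sigma>] measurable_cong_sets[OF sets_\<pi> sets_empirical])
    show fst_d: "distr \<pi> \<sigma> fst = \<sigma>"
    proof (rule measure_eqI)
      fix A assume "A \<in> sets (distr \<pi> \<sigma> fst)"
      then have A: "A \<in> sets \<sigma>" "A \<in> sets sphere_borel" by (simp_all add: sets_\<sigma>)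
      have sub: "A \<subseteq> unit_sphere" using sets.sets_into_space[OF A(2)] by simp
      have "emeasure (distr \<pi> \<sigma> fst) A = emeasure \<pi> (A \<times> unit_sphere)"
        using A sub by (subst emeasure_distr[OF fst_m])
          (auto simp: space_\<pi> intro!: arg_cong2[where f = emeasure])
      also have "\<dots> = (\<Sum>w\<in>W. \<integral>\<^sup>+b. h w b * indicator (A \<times> unit_sphere) (\<phi> b, q w) \<partial>B)"
        using A(2) sets.top[of sphere_borel] by (intro ind pair_measureI) (auto simp del: sets.top)
      also have "\<dots> = (\<Sum>w\<in>W. \<integral>\<^sup>+b. h w b * indicator A (\<phi> b) \<partial>B)"
        using q by (intro sum.cong refl nn_integral_cong) (auto simp: indicator_def)
      also have "\<dots> = (\<integral>\<^sup>+b. (\<Sum>w\<in>W. h w b * indicator A (\<phi> b)) \<partial>B)"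
        using A(2) by (intro nn_integral_sum[symmetric]) simp
      also have "\<dots> = (\<integral>\<^sup>+b. indicator A (\<phi> b) \<partial>B)"
        using row by (intro nn_integral_cong_AE) (auto simp: sum_distrib_right[symmetric])
      also have "\<dots> = (\<integral>\<^sup>+x. indicator A x \<partial>\<sigma>)"
        unfolding dB[symmetric] using A(2) by (intro nn_integral_distr[symmetric]) auto
      also have "\<dots> = emeasure \<sigma> A" using A by simp
      finally show "emeasure (distr \<pi> \<sigma> fst) A = emeasure \<sigma> A" .
    qed simp
    show "distr \<pi> ?\<nu> snd = ?\<nu>"
    proof (rule measure_eqI)
      fix A assume "A \<in> sets (distr \<pi> ?\<nu> snd)"
      then have A: "A \<in> sets sphere_borel" by simp
      have sub: "A \<subseteq> unit_sphere" using sets.sets_into_space[OF A] by simp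
      have "emeasure (distr \<pi> ?\<nu> snd) A = emeasure \<pi> (unit_sphere \<times> A)"
        using A sub by (subst emeasure_distr[OF snd_m])
          (auto simp: space_\<pi> intro!: arg_cong2[where f = emeasure])
      also have "\<dots> = (\<Sum>w\<in>W. \<integral>\<^sup>+b. h w b * indicator (unit_sphere \<times> A) (\<phi> b, q w) \<partial>B)"
        using A sets.top[of sphere_borel] by (intro ind pair_measureI) (auto simp del: sets.top)
      also have "\<dots> = (\<Sum>w\<in>W. \<integral>\<^sup>+b. h w b * indicator A (q w) \<partial>B)"
        using \<phi>_sphere by (intro sum.cong refl nn_integral_cong) (auto simp: indicator_def)
      also have "\<dots> = (\<Sum>w\<in>W. ennreal (1 / card W) * indicator A (q w))"
        by (intro sum.cong refl) (simp add: nn_integral_multc col)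
      also have "\<dots> = (\<Sum>w\<in>{w\<in>W. q w \<in> A}. ennreal (1 / card W))"
        using W(1) by (intro sum.mono_neutral_cong_right) (auto simp: indicator_def)
      also have "\<dots> = emeasure ?\<nu> A"
        using card_W_pos
        by (simp add: emeasure_empirical[OF q A] ennreal_of_nat_eq_real_of_nat ennreal_mult'[symmetric])
      finally show "emeasure (distr \<pi> ?\<nu> snd) A = emeasure ?\<nu> A" .
    qed simp
    have "emeasure \<pi> (space \<pi>) = emeasure (distr \<pi> \<sigma> fst) (space \<sigma>)"
      using fst_m sets.top[of \<sigma>] by (subst emeasure_distr) (auto simp: space_\<pi> intro!: arg_cong2[where f = emeasure])
    then show "prob_space \<pi>"
      unfolding fst_d by (intro prob_spaceI) (simp add: emeasure_space_1[simplified])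
    show "sets \<pi> = sets (\<sigma> \<Otimes>\<^sub>M ?\<nu>)" by (simp only: sets_\<pi> sets_eq)
  qed
  then have "wasserstein1 \<sigma> ?\<nu> \<le> (\<integral>\<^sup>+p. ennreal (dist (fst p) (snd p)) \<partial>\<pi>)"
    unfolding wasserstein1_def by (rule INF_lower)
  also have "\<dots> = (\<Sum>w\<in>W. \<integral>\<^sup>+b. h w b * ennreal (dist (\<phi> b) (q w)) \<partial>B)"
  proof (subst key)
    have [measurable]: "fst \<in> borel_measurable (sphere_borel \<Otimes>\<^sub>M (sphere_borel :: 'a measure))"
       "snd \<in> borel_measurable ((sphere_borel :: 'a measure) \<Otimes>\<^sub>M sphere_borel)"
      by (auto intro: measurable_sphere_borelD)
    show "(\<lambda>p. ennreal (dist (fst p) (snd p)))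
        \<in> borel_measurable ((sphere_borel :: 'a measure) \<Otimes>\<^sub>M sphere_borel)"
      by measurable
  qed simp
  finally show ?thesis .
qed

text \<open>A coupling with the second family is rerouted: the mass it sends to \<open>q' w\<close>
  is passed on to \<open>q w\<close>, which adds at most c to the distance travelled.\<close>

lemma wasserstein1_empirical_lipschitz:
  assumes q: "q \<in> W \<rightarrow> unit_sphere" and q': "q' \<in> W \<rightarrow> unit_sphere"
    and c: "\<And>w. w \<in> W \<Longrightarrow> dist (q w) (q' w) \<le> c"
  shows "wasserstein1 \<sigma> (empirical W q) \<le> wasserstein1 \<sigma> (empirical W q') + ennreal c"
proof -
  have c0: "c \<ge> 0" using c W(2) by (metis ex_in_conv order_trans zero_le_dist)
  have step: "wasserstein1 \<sigma> (empirical W q) \<le> (\<integral>\<^sup>+p. ennreal (dist (fst p) (snd p)) \<partial>\<pi>) + ennreal c"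
    if "\<pi> \<in> couplings \<sigma> (empirical W q')" for \<pi>
  proof -
    let ?\<nu> = "empirical W q'"
    from that have \<pi>: "prob_space \<pi>" and sets_\<pi>: "sets \<pi> = sets (\<sigma> \<Otimes>\<^sub>M ?\<nu>)"
      and d1: "distr \<pi> \<sigma> fst = \<sigma>" and d2: "distr \<pi> ?\<nu> snd = ?\<nu>"
      by (auto simp: couplings_def)
    interpret P: prob_space \<pi> by (rule \<pi>)
    have sets_\<pi>': "sets \<pi> = sets (sphere_borel \<Otimes>\<^sub>M sphere_borel)"
      unfolding sets_\<pi> by (intro sets_pair_measure_cong sets_\<sigma>) simp
    have fst_m: "fst \<in> measurable \<pi> sphere_borel" and snd_m: "snd \<in> measurable \<pi> sphere_borel"
      by (auto simp: measurable_cong_sets[OF sets_\<pi>' refl])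
    note [measurable] = measurable_sphere_borelD[OF fst_m] measurable_sphere_borelD[OF snd_m]
    have e2: "emeasure \<pi> {p \<in> space \<pi>. snd p \<in> A} = emeasure ?\<nu> A" if "A \<in> sets sphere_borel" for A
    proof -
      have "emeasure ?\<nu> A = emeasure (distr \<pi> ?\<nu> snd) A" by (simp add: d2)
      also have "\<dots> = emeasure \<pi> (snd -` A \<inter> space \<pi>)"
        using that snd_m by (intro emeasure_distr) (auto simp: measurable_cong_sets[OF refl sets_empirical])
      finally show ?thesis by (simp add: vimage_def Int_def conj_commute)
    qed
    \<comment> \<open>The points \<open>q' w\<close> may coincide. Mass arriving at one of them is
      shared equally among its indices, so that each index receives
      \<open>1 / card W\<close>.\<close>
    define mult where "mult = (\<lambda>y. card {w \<in> W. q' w = y})"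
    have mult_pos: "mult (q' w) > 0" if "w \<in> W" for w
      using that W by (auto simp: mult_def card_gt_0_iff)
    define h where "h = (\<lambda>w (p :: 'a \<times> 'a). ennreal (1 / mult (q' w)) * indicator {p. snd p = q' w} p)"
    have hm: "h w \<in> borel_measurable \<pi>" if "w \<in> W" for w
      unfolding h_def by measurable
    have sing: "{y} \<in> sets sphere_borel" if "y \<in> unit_sphere" for y :: 'a
      using that by (auto simp: sets_restrict_space_iff)
    have img: "q' ` W \<in> sets sphere_borel"
      using q' W(1) by (auto simp: sets_restrict_space_iff intro!: borel_closed[OF finite_imp_closed])
    have "{w \<in> W. q' w \<in> q' ` W} = W" by auto
    then have "emeasure \<pi> {p \<in> space \<pi>. snd p \<in> q' ` W} = 1"
      using card_W_pos by (simp add: e2[OF img] emeasure_empirical[OF q' img])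
    then have "P.prob {p \<in> space \<pi>. snd p \<in> q' ` W} = 1"
      by (simp add: measure_def)
    from P.AE_prob_1[OF this] have AE_img: "AE p in \<pi>. snd p \<in> q' ` W"
      by (rule AE_mp) (intro AE_I2, simp)
    have row: "AE p in \<pi>. (\<Sum>w\<in>W. h w p) = 1"
      using AE_img
    proof (rule AE_mp, intro AE_I2 impI)
      fix p :: "'a \<times> 'a" assume "snd p \<in> q' ` W"
      then obtain w0 where w0: "w0 \<in> W" "snd p = q' w0" by auto
      have "(\<Sum>w\<in>W. h w p) = (\<Sum>w\<in>{w \<in> W. q' w = snd p}. ennreal (1 / mult (snd p)))"
        using W(1) by (intro sum.mono_neutral_cong_right) (auto simp: h_def indicator_def)
      also have "\<dots> = of_nat (mult (snd p)) * ennreal (1 / mult (snd p))"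
        by (simp add: mult_def)
      also have "\<dots> = 1"
        using mult_pos[OF w0(1)] w0(2) by (simp add: ennreal_of_nat_eq_real_of_nat ennreal_mult'[symmetric])
      finally show "(\<Sum>w\<in>W. h w p) = 1" .
    qed
    have col: "(\<integral>\<^sup>+p. h w p \<partial>\<pi>) = ennreal (1 / card W)" if w: "w \<in> W" for w
    proof -
      have y: "q' w \<in> unit_sphere" using q' w by auto
      have "(\<integral>\<^sup>+p. h w p \<partial>\<pi>) = (\<integral>\<^sup>+p. ennreal (1 / mult (q' w)) * indicator {p \<in> space \<pi>. snd p \<in> {q' w}} p \<partial>\<pi>)"
        by (intro nn_integral_cong) (auto simp: h_def indicator_def)
      also have "\<dots> = ennreal (1 / mult (q' w)) * emeasure \<pi> {p \<in> space \<pi>. snd p \<in> {q' w}}"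
        by (intro nn_integral_cmult_indicator) auto
      also have "\<dots> = ennreal (1 / mult (q' w)) * ennreal (mult (q' w) / card W)"
        by (simp add: e2[OF sing[OF y], simplified] emeasure_empirical[OF q' sing[OF y]] mult_def)
      also have "\<dots> = ennreal (1 / card W)"
        using mult_pos[OF w] by (simp add: ennreal_mult'[symmetric])
      finally show ?thesis .
    qed
    have "wasserstein1 \<sigma> (empirical W q) \<le> (\<Sum>w\<in>W. \<integral>\<^sup>+p. h w p * ennreal (dist (fst p) (q w)) \<partial>\<pi>)"
    proof (rule wasserstein1_le_assignment[OF q \<pi> fst_m _ hm row col])
      have "distr \<pi> sphere_borel fst = distr \<pi> \<sigma> fst"
        by (intro distr_cong refl) (simp add: sets_\<sigma>)
      then show "distr \<pi> sphere_borel fst = \<sigma>" by (simp add: d1)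
    qed
    also have "\<dots> = (\<integral>\<^sup>+p. (\<Sum>w\<in>W. h w p * ennreal (dist (fst p) (q w))) \<partial>\<pi>)"
      using hm measurable_sphere_borelD[OF fst_m]
      by (intro nn_integral_sum[symmetric] borel_measurable_times_ennreal measurable_compose[OF _ measurable_ennreal]
          borel_measurable_dist) auto
    also have "\<dots> \<le> (\<integral>\<^sup>+p. ennreal (dist (fst p) (snd p)) + ennreal c \<partial>\<pi>)"
    proof (rule nn_integral_mono_AE, use row in \<open>rule AE_mp\<close>, intro AE_I2 impI)
      fix p assume s: "(\<Sum>w\<in>W. h w p) = 1"
      have "(\<Sum>w\<in>W. h w p * ennreal (dist (fst p) (q w)))
          \<le> (\<Sum>w\<in>W. h w p * (ennreal (dist (fst p) (snd p)) + ennreal c))"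
      proof (rule sum_mono)
        fix w assume w: "w \<in> W"
        show "h w p * ennreal (dist (fst p) (q w)) \<le> h w p * (ennreal (dist (fst p) (snd p)) + ennreal c)"
        proof (cases "snd p = q' w")
          case True
          have "dist (fst p) (q w) \<le> dist (fst p) (snd p) + c"
            using dist_triangle[of "fst p" "q w" "q' w"] c[OF w] by (simp add: True dist_commute)
          then show ?thesis
            using c0 by (intro mult_left_mono) (auto simp: ennreal_plus[symmetric] simp del: ennreal_plus intro!: ennreal_leI)
        qed (simp add: h_def)
      qed
      then show "(\<Sum>w\<in>W. h w p * ennreal (dist (fst p) (q w))) \<le> ennreal (dist (fst p) (snd p)) + ennreal c"
        by (simp add: sum_distrib_right[symmetric] s)
    qed
    also have "\<dots> = (\<integral>\<^sup>+p. ennreal (dist (fst p) (snd p)) \<partial>\<pi>) + ennreal c"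
      by (subst nn_integral_add) (auto simp: P.emeasure_space_1)
    finally show ?thesis .
  qed
  \<comment> \<open>No optimal coupling is at hand, so c is moved to the left before passing to the
    infimum.\<close>
  have "wasserstein1 \<sigma> (empirical W q) - ennreal c \<le> wasserstein1 \<sigma> (empirical W q')"
    unfolding wasserstein1_def[of _ "empirical W q'"]
    using step by (intro INF_greatest) (auto simp: ennreal_minus_le_iff add.commute)
  then show ?thesis by (simp add: ennreal_minus_le_iff add.commute)
qed

text \<open>The coupling keeps the common part \<open>min g 1\<close> in place and spreads the excess \<open>c w\<close> of each
  \<open>f w\<close> over the deficit \<open>max 0 (1 - g)\<close>. If \<open>m = 0\<close>, the junk value \<open>x / 0 = 0\<close> is the right one.\<close>

lemma wasserstein1_le_densities:
  fixes f :: "'w \<Rightarrow> 'a \<Rightarrow> real"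
  defines "g \<equiv> \<lambda>y. (\<Sum>w\<in>W. f w y) / card W"
  assumes q: "q \<in> W \<rightarrow> unit_sphere"
    and f_int: "\<And>w. w \<in> W \<Longrightarrow> integrable \<sigma> (f w)"
    and f_nonneg: "\<And>w y. w \<in> W \<Longrightarrow> f w y \<ge> 0"
    and f_one: "\<And>w. w \<in> W \<Longrightarrow> (\<integral>y. f w y \<partial>\<sigma>) = 1"
    and f_supp: "\<And>w y. w \<in> W \<Longrightarrow> f w y \<noteq> 0 \<Longrightarrow> dist y (q w) \<le> \<rho>"
  shows "wasserstein1 \<sigma> (empirical W q) \<le> ennreal (\<rho> + (\<integral>y. \<bar>g y - 1\<bar> \<partial>\<sigma>))"
proof -
  note f_m [measurable] = borel_measurable_integrable[OF f_int]
  have [measurable]: "g \<in> borel_measurable \<sigma>" unfolding g_def by measurable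
  have g_int: "integrable \<sigma> g"
    unfolding g_def by (intro integrable_divide Bochner_Integration.integrable_sum f_int)
  have g0: "g y \<ge> 0" for y
    unfolding g_def by (intro divide_nonneg_nonneg sum_nonneg f_nonneg) auto
  have g_one: "(\<integral>y. g y \<partial>\<sigma>) = 1"
    unfolding g_def using card_W_pos by (simp add: f_int f_one)
  define m where "m = (\<integral>y. max 0 (1 - g y) \<partial>\<sigma>)"
  have dm_int: "integrable \<sigma> (\<lambda>y. max 0 (1 - g y))" and dp_int: "integrable \<sigma> (\<lambda>y. max 0 (g y - 1))"
    using g_int by (auto intro!: integrable_max)
  have m0: "m \<ge> 0" unfolding m_def by (intro integral_nonneg_AE) auto
  have "(\<integral>y. max 0 (g y - 1) \<partial>\<sigma>) - m = (\<integral>y. max 0 (g y - 1) - max 0 (1 - g y) \<partial>\<sigma>)"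
    unfolding m_def using dm_int dp_int by simp
  also have "\<dots> = (\<integral>y. g y - 1 \<partial>\<sigma>)"
    by (intro Bochner_Integration.integral_cong) auto
  also have "\<dots> = 0" using g_int g_one by (simp add: prob_space[simplified])
  finally have mp: "(\<integral>y. max 0 (g y - 1) \<partial>\<sigma>) = m" by simp
  have abs_eq: "(\<integral>y. \<bar>g y - 1\<bar> \<partial>\<sigma>) = 2 * m"
  proof -
    have "(\<integral>y. \<bar>g y - 1\<bar> \<partial>\<sigma>) = (\<integral>y. max 0 (g y - 1) + max 0 (1 - g y) \<partial>\<sigma>)"
      by (intro Bochner_Integration.integral_cong) auto
    then show ?thesis using dm_int dp_int mp by (simp add: m_def)
  qed
  \<comment> \<open>The common part \<open>min g 1\<close> equals \<open>g / max 1 g\<close>; the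
    quotient here is the contribution of index w to it, before averaging.\<close>
  have fd_le: "f w y / max 1 (g y) \<le> f w y" if "w \<in> W" for w y
    using divide_left_mono[of 1 "max 1 (g y)" "f w y"] f_nonneg[OF that] by simp
  have fd_int: "integrable \<sigma> (\<lambda>y. f w y / max 1 (g y))" if "w \<in> W" for w
    using that f_nonneg[OF that] fd_le[OF that]
    by (intro Bochner_Integration.integrable_bound[OF f_int[OF that]]) auto
  define c where "c = (\<lambda>w. 1 - (\<integral>y. f w y / max 1 (g y) \<partial>\<sigma>))"
  have c0: "c w \<ge> 0" if "w \<in> W" for w
  proof -
    have "(\<integral>y. f w y / max 1 (g y) \<partial>\<sigma>) \<le> (\<integral>y. f w y \<partial>\<sigma>)"
      using that by (intro integral_mono fd_int f_int fd_le)
    then show ?thesis by (simp add: c_def f_one that)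
  qed
  have sum_c: "(\<Sum>w\<in>W. c w) = card W * m"
  proof -
    have "(\<Sum>w\<in>W. \<integral>y. f w y / max 1 (g y) \<partial>\<sigma>) = (\<integral>y. card W * (g y / max 1 (g y)) \<partial>\<sigma>)"
    proof -
      have "(\<Sum>w\<in>W. f w y / max 1 (g y)) = card W * (g y / max 1 (g y))" for y
        using card_W_pos by (simp only: sum_divide_distrib[symmetric]) (simp add: g_def)
      then show ?thesis
        using fd_int by (subst Bochner_Integration.integral_sum[symmetric]) auto
    qed
    also have "\<dots> = card W * (\<integral>y. g y - max 0 (g y - 1) \<partial>\<sigma>)"
    proof -
      have "g y / max 1 (g y) = g y - max 0 (g y - 1)" for y by (auto simp: max_def)
      then show ?thesis by simp
    qed
    also have "\<dots> = card W * (1 - m)" using g_int dp_int g_one mp by simp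
    finally show ?thesis by (simp add: c_def sum_subtractf algebra_simps)
  qed
  define h where "h = (\<lambda>w y. (f w y / max 1 (g y) + c w * max 0 (1 - g y) / m) / card W)"
  have h0: "h w y \<ge> 0" if "w \<in> W" for w y
    unfolding h_def using that m0 by (intro divide_nonneg_nonneg add_nonneg_nonneg mult_nonneg_nonneg f_nonneg c0) auto
  have h_int: "integrable \<sigma> (h w)" if "w \<in> W" for w
    unfolding h_def using fd_int[OF that] dm_int by auto
  have zero_case: "c w * (m / m) = c w" if "w \<in> W" for w
  proof (cases "m = 0")
    case True
    then have "\<forall>w\<in>W. c w = 0" using sum_c sum_nonneg_eq_0_iff[OF W(1), of c] c0 by auto
    then show ?thesis using that by simp
  qed simp
  have "wasserstein1 \<sigma> (empirical W q)
      \<le> (\<Sum>w\<in>W. \<integral>\<^sup>+y. ennreal (h w y) * ennreal (dist y (q w)) \<partial>\<sigma>)"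
  proof (rule wasserstein1_le_assignment[OF q prob_space_axioms])
    show "(\<lambda>y. y) \<in> measurable \<sigma> sphere_borel" by simp
    show "distr \<sigma> sphere_borel (\<lambda>y. y) = \<sigma>" by (rule distr_id2) (simp add: sets_\<sigma>)
    show "(\<lambda>y. ennreal (h w y)) \<in> borel_measurable \<sigma>" if "w \<in> W" for w
      using borel_measurable_integrable[OF h_int[OF that]] by simp
    show "(\<integral>\<^sup>+y. ennreal (h w y) \<partial>\<sigma>) = ennreal (1 / card W)" if w: "w \<in> W" for w
    proof -
      have "(\<integral>y. h w y \<partial>\<sigma>) = ((1 - c w) + c w * (m / m)) / card W"
        unfolding h_def using fd_int[OF w] dm_int by (simp add: c_def m_def)
      then have "(\<integral>y. h w y \<partial>\<sigma>) = 1 / card W" by (simp only: zero_case[OF w]) simp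
      then show ?thesis using w h0 h_int by (simp add: nn_integral_eq_integral)
    qed
    \<comment> \<open>If m = 0, then g >= 1 only almost everywhere, which is why the row sums are 1
      almost everywhere and not pointwise.\<close>
    have "AE y in \<sigma>. m = 0 \<longrightarrow> max 0 (1 - g y) = 0"
    proof (cases "m = 0")
      case True
      then show ?thesis
        using integral_nonneg_eq_0_iff_AE[OF dm_int] by (auto simp: m_def)
    qed simp
    then show "AE y in \<sigma>. (\<Sum>w\<in>W. ennreal (h w y)) = 1"
    proof (rule AE_mp, intro AE_I2 impI)
      fix y assume y: "m = 0 \<longrightarrow> max 0 (1 - g y) = 0"
      have "(\<Sum>w\<in>W. h w y) = g y / max 1 (g y) + (\<Sum>w\<in>W. c w) * max 0 (1 - g y) / m / card W"
        by (simp add: h_def g_def sum_divide_distrib sum.distrib add_divide_distrib sum_distrib_right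
            mult.commute)
      also have "\<dots> = g y / max 1 (g y) + m * max 0 (1 - g y) / m"
        using card_W_pos by (simp add: sum_c)
      also have "\<dots> = 1"
        using y g0[of y] by (cases "m = 0") (auto simp: max_def split: if_splits)
      finally show "(\<Sum>w\<in>W. ennreal (h w y)) = 1" using h0 by (simp add: sum_ennreal)
    qed
  qed
  also have "\<dots> \<le> (\<Sum>w\<in>W. ennreal ((\<rho> + 2 * c w) / card W))"
  proof (rule sum_mono)
    fix w assume w: "w \<in> W"
    let ?k = "\<lambda>y. (\<rho> * f w y + 2 * (c w * max 0 (1 - g y) / m)) / card W"
    have k_int: "integrable \<sigma> ?k" using f_int[OF w] dm_int by auto
    have hk: "h w y * dist y (q w) \<le> ?k y" if y: "y \<in> space \<sigma>" for y
    proof -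
      \<comment> \<open>The redistributed mass m may go anywhere, so it is charged the diameter 2;
        the total 2m is exactly the L1 norm of g - 1.\<close>
      have d2: "dist y (q w) \<le> 2"
        using dist_triangle2[of y "q w" 0] y q w by (auto simp: Pi_iff)
      have "f w y / max 1 (g y) * dist y (q w) \<le> f w y * \<rho>"
      proof (cases "f w y = 0")
        case False
        then show ?thesis
          using f_supp[OF w False] f_nonneg[OF w] by (intro mult_mono fd_le w) auto
      qed simp
      moreover have "c w * max 0 (1 - g y) / m * dist y (q w) \<le> c w * max 0 (1 - g y) / m * 2"
        using d2 c0[OF w] m0 by (intro mult_left_mono divide_nonneg_nonneg mult_nonneg_nonneg) auto
      ultimately have "(f w y / max 1 (g y) + c w * max 0 (1 - g y) / m) * dist y (q w)
          \<le> \<rho> * f w y + 2 * (c w * max 0 (1 - g y) / m)"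
        unfolding distrib_right by (intro add_mono) (simp_all add: mult.commute)
      from divide_right_mono[OF this, of "card W"] show ?thesis by (simp add: h_def)
    qed
    have "(\<integral>\<^sup>+y. ennreal (h w y) * ennreal (dist y (q w)) \<partial>\<sigma>) \<le> (\<integral>\<^sup>+y. ennreal (?k y) \<partial>\<sigma>)"
      using hk h0[OF w] by (intro nn_integral_mono) (simp add: ennreal_mult'[symmetric] ennreal_leI)
    also have "\<dots> = ennreal (\<integral>y. ?k y \<partial>\<sigma>)"
    proof (intro nn_integral_eq_integral k_int AE_I2)
      fix y assume "y \<in> space \<sigma>"
      from hk[OF this] h0[OF w, of y] show "0 \<le> ?k y" by (meson mult_nonneg_nonneg order_trans zero_le_dist)
    qed
    also have "(\<integral>y. ?k y \<partial>\<sigma>) = (\<rho> * 1 + 2 * (c w * (m / m))) / card W"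
      using f_int[OF w] dm_int by (simp add: f_one[OF w] m_def)
    also have "\<dots> = (\<rho> + 2 * c w) / card W" by (simp only: zero_case[OF w]) simp
    finally show "(\<integral>\<^sup>+y. ennreal (h w y) * ennreal (dist y (q w)) \<partial>\<sigma>) \<le> ennreal ((\<rho> + 2 * c w) / card W)" .
  qed
  also have "\<dots> = ennreal (\<Sum>w\<in>W. (\<rho> + 2 * c w) / card W)"
  proof (rule sum_ennreal)
    fix w assume w: "w \<in> W"
    \<comment> \<open>Nonnegativity of \<rho> comes from a point where \<open>f w\<close> is
      nonzero, and such a point exists because the integral is 1.\<close>
    have "f w \<noteq> (\<lambda>_. 0)" using f_one[OF w] by auto
    then obtain y where "f w y \<noteq> 0" by auto
    from f_supp[OF w this] have "\<rho> \<ge> 0" by (meson order_trans zero_le_dist)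
    then show "0 \<le> (\<rho> + 2 * c w) / card W" using c0[OF w] by simp
  qed
  also have "(\<Sum>w\<in>W. (\<rho> + 2 * c w) / card W) = (card W * \<rho> + 2 * (\<Sum>w\<in>W. c w)) / card W"
    by (simp only: sum_divide_distrib[symmetric] sum.distrib sum_distrib_left sum_constant)
  also have "\<dots> = \<rho> + 2 * m"
    using card_W_pos by (simp add: sum_c field_simps)
  finally show ?thesis by (simp add: abs_eq)
qed

text \<open>A Lipschitz function of the points is the infimum, over a countable dense set of
  configurations d, of its value at d plus the distance to d. This replaces the uncountable infimum
  over couplings by a countable one of measurable functions.\<close>

lemma measurable_wasserstein1_le:
  assumes Q: "\<And>w. w \<in> W \<Longrightarrow> (\<lambda>S. Q S w) \<in> measurable M sphere_borel"
  shows "{S \<in> space M. wasserstein1 \<sigma> (empirical W (Q S)) \<le> e} \<in> sets M"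
proof -
  obtain D where D: "countable D" "D \<subseteq> (unit_sphere :: 'a set)" "unit_sphere \<subseteq> closure D"
    using separable by blast
  let ?I = "W \<rightarrow>\<^sub>E D"
  define R where "R = (\<lambda>S. INF d\<in>?I. wasserstein1 \<sigma> (empirical W d) + ennreal (\<Sum>w\<in>W. dist (Q S w) (d w)))"
  have "countable ?I" using W(1) D(1) by (intro countable_PiE) auto
  note [measurable] = measurable_sphere_borelD[OF Q]
  have R_m: "R \<in> borel_measurable M"
    unfolding R_def by (intro borel_measurable_INF \<open>countable ?I\<close>) measurable
  have eq: "wasserstein1 \<sigma> (empirical W (Q S)) = R S" if S: "S \<in> space M" for S
  proof (rule antisym)
    have QS: "Q S \<in> W \<rightarrow> unit_sphere" using measurable_space[OF Q S] by auto
    have term_le: "dist (Q S w) (d w) \<le> (\<Sum>w\<in>W. dist (Q S w) (d w))" if "w \<in> W" for w d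
      using that W(1) by (intro member_le_sum) auto
    show "wasserstein1 \<sigma> (empirical W (Q S)) \<le> R S"
      unfolding R_def
    proof (rule INF_greatest)
      fix d assume "d \<in> ?I"
      then have "d \<in> W \<rightarrow> unit_sphere" using D(2) by (auto simp: PiE_iff)
      from wasserstein1_empirical_lipschitz[OF QS this term_le]
      show "wasserstein1 \<sigma> (empirical W (Q S))
          \<le> wasserstein1 \<sigma> (empirical W d) + ennreal (\<Sum>w\<in>W. dist (Q S w) (d w))" .
    qed
    show "R S \<le> wasserstein1 \<sigma> (empirical W (Q S))"
    proof (rule ennreal_le_epsilon)
      fix e :: real assume e: "e > 0"
      \<comment> \<open>The total displacement is then at most e/2. It is paid twice, once inside
        \<open>R\<close> and once through the Lipschitz estimate.\<close>
      define \<eta> where "\<eta> = e / (2 * card W)"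
      have \<eta>: "\<eta> > 0" using e card_W_pos by (simp add: \<eta>_def)
      have "\<exists>y\<in>D. dist (Q S w) y \<le> \<eta>" if "w \<in> W" for w
      proof -
        have "Q S w \<in> closure D" using that QS D(3) by auto
        then show ?thesis
          using \<eta> unfolding closure_approachable by (auto simp: dist_commute intro: less_imp_le)
      qed
      then obtain d0 where d0: "\<And>w. w \<in> W \<Longrightarrow> d0 w \<in> D \<and> dist (Q S w) (d0 w) \<le> \<eta>" by metis
      define d where "d = restrict d0 W"
      have d: "d \<in> ?I" "\<And>w. w \<in> W \<Longrightarrow> dist (Q S w) (d w) \<le> \<eta>" using d0 by (auto simp: d_def)
      have dW: "d \<in> W \<rightarrow> unit_sphere" using d(1) D(2) by (auto simp: PiE_iff)
      have sum_le: "(\<Sum>w\<in>W. dist (Q S w) (d w)) \<le> e / 2"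
        using sum_bounded_above[of W "\<lambda>w. dist (Q S w) (d w)" \<eta>] d(2) card_W_pos by (simp add: \<eta>_def)
      have "R S \<le> wasserstein1 \<sigma> (empirical W d) + ennreal (\<Sum>w\<in>W. dist (Q S w) (d w))"
        unfolding R_def using d(1) by (rule INF_lower)
      also have "\<dots> \<le> (wasserstein1 \<sigma> (empirical W (Q S)) + ennreal (e / 2)) + ennreal (e / 2)"
      proof (intro add_mono ennreal_leI sum_le wasserstein1_empirical_lipschitz[OF dW QS])
        fix w assume "w \<in> W"
        from term_le[OF this, of d] sum_le show "dist (d w) (Q S w) \<le> e / 2" by (simp add: dist_commute)
      qed
      also have "\<dots> = wasserstein1 \<sigma> (empirical W (Q S)) + ennreal e"
        using e by (simp add: add.assoc ennreal_plus[symmetric] del: ennreal_plus)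
      finally show "R S \<le> wasserstein1 \<sigma> (empirical W (Q S)) + ennreal e" .
    qed
  qed
  have "{S \<in> space M. wasserstein1 \<sigma> (empirical W (Q S)) \<le> e} = {S \<in> space M. R S \<le> e}"
    using eq by auto
  also have "\<dots> \<in> sets M" using R_m by measurable
  finally show ?thesis .
qed

end

section \<open>Spherical caps\<close>

context haar_SO
begin

text \<open>Caps are taken in the chordal distance used by W_1; by \<open>measure_cap\<close> the
  choice of centre is immaterial.\<close>

definition cap_measure :: "real \<Rightarrow> real" where
  "cap_measure \<rho> = measure \<sigma> {y \<in> unit_sphere. dist (SOME p. p \<in> unit_sphere) y \<le> \<rho>}"

lemma cap_sets: "{y \<in> unit_sphere. dist x y \<le> \<rho>} \<in> sets \<sigma>"
proof -
  have "{y \<in> unit_sphere. dist x y \<le> \<rho>} = cball x \<rho> \<inter> (unit_sphere :: (real^'n) set)" by auto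
  then show ?thesis by (simp add: sets_sphere_measure sets_restrict_space_iff)
qed

lemma measure_cap:
  assumes x: "x \<in> unit_sphere"
  shows "measure \<sigma> {y \<in> unit_sphere. dist x y \<le> \<rho>} = cap_measure \<rho>"
proof -
  define p :: "real^'n" where "p = (SOME p. p \<in> unit_sphere)"
  have p: "p \<in> unit_sphere" unfolding p_def by (rule some_in_sphere)
  obtain B where B: "B \<in> SO" "B *v p = x" using SO_transitive[OF card2 p x] .
  have iso: "dist (B *v p) (B *v y) = dist p y" for y
    using norm_SO[OF B(1), of "p - y"] by (simp add: dist_norm matrix_vector_mult_diff_distrib)
  have m: "(\<lambda>y. B *v y) \<in> measurable \<sigma> sphere_borel"
    using B(1) by (intro measurable_sphere_borelI)
      (auto simp: norm_SO measurable_cong_sets[OF sets_sphere_measure refl] intro: measurable_restrict_space1)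
  have "measure \<sigma> {y \<in> unit_sphere. dist x y \<le> \<rho>}
      = measure (distr \<sigma> sphere_borel (\<lambda>y. B *v y)) {y \<in> unit_sphere. dist x y \<le> \<rho>}"
    by (simp only: distr_rotate[OF B(1)])
  also have "\<dots> = measure \<sigma> ((\<lambda>y. B *v y) -` {y \<in> unit_sphere. dist x y \<le> \<rho>} \<inter> space \<sigma>)"
    using m cap_sets by (intro measure_distr) (simp_all add: sets_sphere_measure)
  also have "(\<lambda>y. B *v y) -` {y \<in> unit_sphere. dist x y \<le> \<rho>} \<inter> space \<sigma> = {y \<in> unit_sphere. dist p y \<le> \<rho>}"
    using B(1) by (auto simp: norm_SO B(2)[symmetric] iso)
  finally show ?thesis by (simp add: cap_measure_def p_def)
qed

text \<open>Pigeonhole: cubes of side 1/m cut the sphere into cells, each contained in the cap of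
  radius \<rho> about any of its points. All these caps have the same measure, so the number of
  cells times that measure is at least 1.\<close>

lemma cap_measure_lower:
  fixes m :: nat
  assumes m: "real CARD('n) \<le> \<rho> * real m" "m > 0"
  shows "1 \<le> (2 * real m + 1) ^ CARD('n) * cap_measure \<rho>"
proof -
  interpret P: prob_space \<sigma> by (rule prob_space_sphere)
  define cell :: "real^'n \<Rightarrow> 'n \<Rightarrow> int" where "cell = (\<lambda>x i. \<lfloor>x $ i * real m\<rfloor>)"
  \<comment> \<open>The floor reaches m only at coordinate 1; this accounts for 2m + 1 values
    instead of 2m.\<close>
  define I where "I = (UNIV :: 'n set) \<rightarrow>\<^sub>E {- int m .. int m}"
  have finI: "finite I" unfolding I_def by (intro finite_PiE) auto
  have cardI: "real (card I) = (2 * real m + 1) ^ CARD('n)"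
    unfolding I_def by (subst card_PiE) (auto simp: prod_constant)
  have cell_I: "cell x \<in> I" if x: "x \<in> unit_sphere" for x
  proof -
    have "\<bar>x $ i * real m\<bar> \<le> real m" for i
      using component_le_norm_cart[of x i] x by (simp add: abs_mult mult_left_le_one_le)
    then have "- real m \<le> x $ i * real m" "x $ i * real m \<le> real m" for i
      by (auto simp: abs_le_iff) (metis abs_le_iff minus_le_iff)
    then show ?thesis
      unfolding I_def cell_def by (auto simp: le_floor_iff floor_le_iff) (metis less_add_one order_le_less_trans)
  qed
  define Cl where "Cl = (\<lambda>c. {x \<in> unit_sphere. cell x = c})"
  have Cl_sets: "Cl c \<in> sets \<sigma>" for c
  proof -
    have "Cl c = unit_sphere \<inter> {x. \<forall>i. \<lfloor>x $ i * real m\<rfloor> = c i}"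
      by (auto simp: Cl_def cell_def fun_eq_iff)
    moreover have "{x :: real^'n. \<forall>i. \<lfloor>x $ i * real m\<rfloor> = c i} \<in> sets borel"
    proof -
      have "(\<lambda>x :: real^'n. x $ i) \<in> borel_measurable borel" for i
        by (intro borel_measurable_continuous_onI continuous_intros)
      then have [measurable]: "(\<lambda>x :: real^'n. x $ i * real m) \<in> borel_measurable borel" for i
        by simp
      have "{x \<in> space borel. \<forall>i. \<lfloor>(x :: real^'n) $ i * real m\<rfloor> = c i} \<in> sets borel"
        by measurable
      then show ?thesis by simp
    qed
    ultimately show ?thesis by (auto simp: sets_sphere_measure sets_restrict_space)
  qed
  have le: "measure \<sigma> (Cl c) \<le> cap_measure \<rho>" for c
  proof (cases "Cl c = {}")
    case True
    then show ?thesis by (simp add: cap_measure_def)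
  next
    case False
    then obtain x where x: "x \<in> Cl c" by auto
    have "dist x y \<le> \<rho>" if y: "y \<in> Cl c" for y
    proof -
      have "\<bar>(x - y) $ i\<bar> \<le> 1 / m" for i
      proof -
        have "\<lfloor>x $ i * real m\<rfloor> = \<lfloor>y $ i * real m\<rfloor>"
          using x y by (auto simp: Cl_def cell_def fun_eq_iff)
        then have "\<bar>x $ i * real m - y $ i * real m\<bar> \<le> 1"
          by linarith
        then have "\<bar>(x - y) $ i\<bar> * real m \<le> 1"
          by (simp add: left_diff_distrib[symmetric] abs_mult)
        then show ?thesis using m(2) by (simp add: field_simps)
      qed
      then have "(\<Sum>i\<in>UNIV. \<bar>(x - y) $ i\<bar>) \<le> CARD('n) * (1 / m)"
        using sum_bounded_above[of "UNIV :: 'n set" "\<lambda>i. \<bar>(x - y) $ i\<bar>" "1 / m"] by simp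
      also have "\<dots> \<le> \<rho>" using m by (simp add: field_simps)
      finally show ?thesis
        using norm_le_l1_cart[of "x - y"] by (simp add: dist_norm)
    qed
    then have "measure \<sigma> (Cl c) \<le> measure \<sigma> {y \<in> unit_sphere. dist x y \<le> \<rho>}"
      by (intro P.finite_measure_mono cap_sets) (auto simp: Cl_def)
    then show ?thesis using measure_cap[of x \<rho>] x by (simp add: Cl_def)
  qed
  have "1 = measure \<sigma> (\<Union>c\<in>I. Cl c)"
  proof -
    have "(\<Union>c\<in>I. Cl c) = space \<sigma>" using cell_I by (auto simp: Cl_def)
    then show ?thesis by (simp only: P.prob_space)
  qed
  also have "\<dots> \<le> (\<Sum>c\<in>I. measure \<sigma> (Cl c))"
    using Cl_sets finI by (intro P.finite_measure_subadditive_finite) auto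
  also have "\<dots> \<le> card I * cap_measure \<rho>"
    using sum_bounded_above[of I "\<lambda>c. measure \<sigma> (Cl c)", OF le] by simp
  finally show ?thesis by (simp add: cardI)
qed

end

section \<open>Concentration of the orbit measure\<close>

context haar_SO
begin

definition cap_density :: "real \<Rightarrow> real^'n \<Rightarrow> real^'n \<Rightarrow> real" where
  "cap_density \<rho> x y = (if dist x y \<le> \<rho> then 1 / cap_measure \<rho> else 0)"

text \<open>The L2 inner product of two centred densities, so that its double sum over a family of
  points is the squared norm of the summed densities.\<close>

definition cap_kernel :: "real \<Rightarrow> real^'n \<Rightarrow> real^'n \<Rightarrow> real" where
  "cap_kernel \<rho> x x' = (\<integral>y. (cap_density \<rho> x y - 1) * (cap_density \<rho> x' y - 1) \<partial>\<sigma>)"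

lemma cap_measure_nonneg: "cap_measure \<rho> \<ge> 0"
  by (simp add: cap_measure_def)

lemma measurable_cap_density:
  assumes "f \<in> measurable M sphere_borel" "g \<in> measurable M sphere_borel"
  shows "(\<lambda>x. cap_density \<rho> (f x) (g x)) \<in> borel_measurable M"
proof -
  have "(\<lambda>x. dist (f x) (g x)) \<in> borel_measurable M"
    by (intro borel_measurable_dist measurable_sphere_borelD assms)
  then show ?thesis unfolding cap_density_def by measurable
qed

lemma cap_density_measurable_2: "x \<in> unit_sphere \<Longrightarrow> cap_density \<rho> x \<in> borel_measurable \<sigma>"
  using measurable_cap_density[of "\<lambda>_. x" \<sigma> "\<lambda>y. y" \<rho>]
  by (simp add: measurable_cong_sets[OF sets_sphere_measure refl])

lemma abs_cap_density_le: "\<bar>cap_density \<rho> x y\<bar> \<le> 1 / cap_measure \<rho>"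
  using cap_measure_nonneg by (simp add: cap_density_def)

lemma cap_density_commute: "cap_density \<rho> x y = cap_density \<rho> y x"
  by (simp add: cap_density_def dist_commute)

lemma cap_density_integrable:
  assumes "x \<in> unit_sphere"
  shows "integrable \<sigma> (cap_density \<rho> x)"
proof -
  interpret P: prob_space \<sigma> by (rule prob_space_sphere)
  show ?thesis
    by (rule P.integrable_const_bound[where B = "1 / cap_measure \<rho>"])
       (use assms in \<open>auto intro: cap_density_measurable_2 abs_cap_density_le\<close>)
qed

lemma cap_density_integral:
  assumes x: "x \<in> unit_sphere" and pos: "cap_measure \<rho> > 0"
  shows "(\<integral>y. cap_density \<rho> x y \<partial>\<sigma>) = 1"
proof -
  have "(\<integral>y. cap_density \<rho> x y \<partial>\<sigma>)
      = (\<integral>y. 1 / cap_measure \<rho> * indicator {y \<in> unit_sphere. dist x y \<le> \<rho>} y \<partial>\<sigma>)"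
    by (intro Bochner_Integration.integral_cong) (auto simp: cap_density_def indicator_def)
  also have "\<dots> = 1 / cap_measure \<rho> * measure \<sigma> {y \<in> unit_sphere. dist x y \<le> \<rho>}"
    using sets.sets_into_space[OF cap_sets] by (simp add: Int_absorb2)
  finally show ?thesis using pos by (simp only: measure_cap[OF x]) simp
qed

text \<open>The bound comes from 2|ab| <= a^2 + b^2 and the diagonal value 1/v - 1, where v is the
  cap measure. The mean vanishes by Fubini, since the density is symmetric in centre and
  argument.\<close>

lemma word_kernel_cap:
  assumes pos: "cap_measure \<rho> > 0" and x0: "x0 \<in> unit_sphere"
  shows "word_kernel \<mu> (cap_kernel \<rho>) (1 / cap_measure \<rho>) x0"
proof -
  interpret P: prob_space \<sigma> by (rule prob_space_sphere)
  let ?v = "cap_measure \<rho>"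
  define F where "F = (\<lambda>x y. cap_density \<rho> x y - 1)"
  have K: "cap_kernel \<rho> x x' = (\<integral>y. F x y * F x' y \<partial>\<sigma>)" for x x' by (simp add: cap_kernel_def F_def)
  have F_m: "F x \<in> borel_measurable \<sigma>" if "x \<in> unit_sphere" for x
    using cap_density_measurable_2[OF that] by (simp add: F_def)
  have F_bound: "\<bar>F x y\<bar> \<le> 1 / ?v + 1" for x y
    using abs_cap_density_le[of \<rho> x y] by (simp add: F_def abs_le_iff)
  have F_int: "integrable \<sigma> (F x)" if "x \<in> unit_sphere" for x
    using cap_density_integrable[OF that] by (simp add: F_def)
  have F_zero: "(\<integral>y. F x y \<partial>\<sigma>) = 0" if "x \<in> unit_sphere" for x
    using cap_density_integrable[OF that] cap_density_integral[OF that pos]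
    by (simp add: F_def P.prob_space[simplified])
  have FF_bound: "\<bar>F x y * F x' y\<bar> \<le> (1 / ?v + 1) * (1 / ?v + 1)" for x x' y
    using pos unfolding abs_mult by (intro mult_mono F_bound) auto
  have FF_int: "integrable \<sigma> (\<lambda>y. F x y * F x' y)" if "x \<in> unit_sphere" "x' \<in> unit_sphere" for x x'
    by (rule P.integrable_const_bound[where B = "(1 / ?v + 1) * (1 / ?v + 1)"])
       (use that in \<open>auto intro!: borel_measurable_times F_m FF_bound\<close>)
  have F_sq: "(\<integral>y. F x y * F x y \<partial>\<sigma>) \<le> 1 / ?v" if x: "x \<in> unit_sphere" for x
  proof -
    \<comment> \<open>The density takes only the values 0 and 1/v, so its square is 1/v times
      itself.\<close>
    have "F x y * F x y = (1 / ?v - 2) * cap_density \<rho> x y + 1" for y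
      by (simp add: F_def cap_density_def algebra_simps)
    then have "(\<integral>y. F x y * F x y \<partial>\<sigma>) = (1 / ?v - 2) * 1 + 1"
      using cap_density_integrable[OF x] cap_density_integral[OF x pos] by (simp add: P.prob_space[simplified])
    then show ?thesis by simp
  qed
  have bound: "\<bar>cap_kernel \<rho> x x'\<bar> \<le> 1 / ?v" if x: "x \<in> unit_sphere" "x' \<in> unit_sphere" for x x'
  proof -
    have "\<bar>cap_kernel \<rho> x x'\<bar> \<le> (\<integral>y. \<bar>F x y * F x' y\<bar> \<partial>\<sigma>)"
      unfolding K by (rule integral_abs_bound)
    also have "\<dots> \<le> (\<integral>y. (F x y * F x y + F x' y * F x' y) / 2 \<partial>\<sigma>)"
    proof (rule integral_mono)
      show "\<bar>F x y * F x' y\<bar> \<le> (F x y * F x y + F x' y * F x' y) / 2" for y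
        using sum_squares_bound[of "\<bar>F x y\<bar>" "\<bar>F x' y\<bar>"] by (simp add: abs_mult power2_eq_square)
    qed (use x FF_int in auto)
    also have "\<dots> = ((\<integral>y. F x y * F x y \<partial>\<sigma>) + (\<integral>y. F x' y * F x' y \<partial>\<sigma>)) / 2"
      using x FF_int by simp
    also have "\<dots> \<le> 1 / ?v" using F_sq[OF x(1)] F_sq[OF x(2)] by simp
    finally show ?thesis .
  qed
  have left: "(\<integral>x. cap_kernel \<rho> x x' \<partial>\<sigma>) = 0" if x': "x' \<in> unit_sphere" for x'
  proof -
    interpret PP: pair_prob_space \<sigma> \<sigma> ..
    have fst_m: "fst \<in> measurable (\<sigma> \<Otimes>\<^sub>M \<sigma>) sphere_borel" and snd_m: "snd \<in> measurable (\<sigma> \<Otimes>\<^sub>M \<sigma>) sphere_borel"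
      by (auto simp: measurable_cong_sets[OF refl sets_sphere_measure, symmetric])
    have "(\<lambda>(x, y). F x y * F x' y) \<in> borel_measurable (\<sigma> \<Otimes>\<^sub>M \<sigma>)"
      unfolding F_def split_def using x'
      by (intro borel_measurable_times borel_measurable_diff measurable_cap_density fst_m snd_m) auto
    then have "integrable (\<sigma> \<Otimes>\<^sub>M \<sigma>) (\<lambda>(x, y). F x y * F x' y)"
      using pos
      by (intro PP.P.integrable_const_bound[where B = "(1 / ?v + 1) * (1 / ?v + 1)"])
         (auto intro!: AE_I2 FF_bound)
    then have "(\<integral>x. cap_kernel \<rho> x x' \<partial>\<sigma>) = (\<integral>y. (\<integral>x. F x y * F x' y \<partial>\<sigma>) \<partial>\<sigma>)"
      unfolding K by (rule PP.Fubini_integral[symmetric])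
    also have "\<dots> = (\<integral>y. 0 \<partial>\<sigma>)"
    proof (intro Bochner_Integration.integral_cong refl)
      fix y assume "y \<in> space \<sigma>"
      then have y: "y \<in> unit_sphere" by simp
      have "(\<integral>x. F x y * F x' y \<partial>\<sigma>) = (\<integral>x. F y x \<partial>\<sigma>) * F x' y"
        by (simp add: F_def cap_density_commute[of _ y])
      then show "(\<integral>x. F x y * F x' y \<partial>\<sigma>) = 0" by (simp add: F_zero[OF y])
    qed
    finally show ?thesis by simp
  qed
  have sym: "cap_kernel \<rho> x x' = cap_kernel \<rho> x' x" for x x'
    unfolding K by (simp add: mult.commute)
  show ?thesis
  proof unfold_locales
    let ?Q = "sphere_borel \<Otimes>\<^sub>M (sphere_borel :: (real^'n) measure)"
    have m: "(\<lambda>p. fst (fst p)) \<in> measurable (?Q \<Otimes>\<^sub>M \<sigma>) sphere_borel"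
        "(\<lambda>p. snd (fst p)) \<in> measurable (?Q \<Otimes>\<^sub>M \<sigma>) sphere_borel"
        "snd \<in> measurable (?Q \<Otimes>\<^sub>M \<sigma>) sphere_borel"
      by (simp_all add: measurable_cong_sets[OF refl sets_sphere_measure, symmetric])
    have "(\<lambda>(q, y). F (fst q) y * F (snd q) y) \<in> borel_measurable (?Q \<Otimes>\<^sub>M \<sigma>)"
      unfolding F_def split_def
      by (intro borel_measurable_times borel_measurable_diff measurable_cap_density m) auto
    then have "(\<lambda>q. \<integral>y. F (fst q) y * F (snd q) y \<partial>\<sigma>) \<in> borel_measurable ?Q"
      by (rule P.borel_measurable_lebesgue_integral)
    then show "case_prod (cap_kernel \<rho>) \<in> borel_measurable ?Q"
      by (simp add: K split_def)
  qed (use bound left x0 in \<open>auto simp: sym[of _ "x'" for x']\<close>)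
qed

text \<open>Outside the event the averaged density deviates from 1 by more than \<eta> in L1, hence
  in L2, and Markov's inequality applies to the p-th power of the squared L2 norm.\<close>

lemma wasserstein1_orbit_tail:
  assumes pos: "cap_measure \<rho> > 0" and x0: "x0 \<in> unit_sphere" and k: "k \<ge> 1" and \<eta>: "\<eta> > 0"
  shows "\<P>(S in (\<Pi>\<^sub>M i\<in>{..<k}. \<mu>). wasserstein1 \<sigma> (orbit_measure S k l x0) \<le> ennreal (\<rho> + \<eta>))
    \<ge> 1 - (1 / (cap_measure \<rho> * \<eta>\<^sup>2)) ^ p
        * card {w \<in> words k (2 * l * p). \<forall>i. count_list (map fst w) i \<noteq> 1} / (2 * real k) ^ (2 * l * p)"
proof -
  let ?P = "\<Pi>\<^sub>M i\<in>{..<k}. \<mu>" and ?W = "words k l"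
  interpret K: word_kernel \<mu> "cap_kernel \<rho>" "1 / cap_measure \<rho>" x0
    by (rule word_kernel_cap[OF pos x0])
  interpret P: prob_space ?P by (rule prob_space_haar_power)
  interpret S: prob_space \<sigma> by (rule prob_space_sphere)
  interpret E: empirical_points \<sigma> ?W
    using words_nonempty[OF k] by unfold_locales (auto simp: finite_words sets_sphere_measure)
  define Q where "Q = (\<lambda>S w. word_product S w *v x0)"
  have orbit: "orbit_measure S k l x0 = empirical ?W (Q S)" for S
    by (simp add: orbit_measure_def empirical_def Q_def)
  have Q_m: "(\<lambda>S. Q S w) \<in> measurable ?P sphere_borel" if "w \<in> ?W" for w
    unfolding Q_def using that x0 by (rule measurable_word_product)
  define Z where "Z = (\<lambda>S. (\<Sum>u\<in>?W. \<Sum>v\<in>?W. cap_kernel \<rho> (Q S u) (Q S v)))"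
  have Z_m [measurable]: "Z \<in> borel_measurable ?P"
    unfolding Z_def by (intro borel_measurable_sum K.measurable_K Q_m)
  let ?good = "{S \<in> space ?P. wasserstein1 \<sigma> (empirical ?W (Q S)) \<le> ennreal (\<rho> + \<eta>)}"
  have good_m: "?good \<in> sets ?P"
    by (rule E.measurable_wasserstein1_le[OF Q_m])
  \<comment> \<open>\<open>Z\<close> is not normalised: it is the squared L2 norm of the deviation
    times the square of the number of words, and c is \<eta>^2 on that scale.\<close>
  define c where "c = (real (card ?W) * \<eta>)\<^sup>2"
  have cW: "real (card ?W) > 0" using E.card_W_pos by simp
  have c0: "c > 0" unfolding c_def using cW \<eta> by simp
  have Z_eq: "Z S = (\<integral>y. (\<Sum>w\<in>?W. cap_density \<rho> (Q S w) y - 1)\<^sup>2 \<partial>\<sigma>)"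
    and main: "Z S < c \<Longrightarrow> S \<in> ?good" if S: "S \<in> space ?P" for S
  proof -
    have Qs: "Q S w \<in> unit_sphere" if "w \<in> ?W" for w
      using measurable_space[OF Q_m[OF that] S] by simp
    define F where "F = (\<lambda>w y. cap_density \<rho> (Q S w) y - 1)"
    have F_bound: "\<bar>F w y\<bar> \<le> 1 / cap_measure \<rho> + 1" for w y
      using abs_cap_density_le[of \<rho> "Q S w" y] by (simp add: F_def abs_le_iff)
    have F_m: "F w \<in> borel_measurable \<sigma>" if "w \<in> ?W" for w
      using cap_density_measurable_2[OF Qs[OF that]] by (simp add: F_def)
    have F_int: "integrable \<sigma> (\<lambda>y. F u y * F v y)" if "u \<in> ?W" "v \<in> ?W" for u v
      by (rule S.integrable_const_bound[where B = "(1 / cap_measure \<rho> + 1) * (1 / cap_measure \<rho> + 1)"])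
         (use that pos in \<open>auto intro!: borel_measurable_times F_m mult_mono F_bound simp: abs_mult\<close>)
    have sq: "(\<Sum>w\<in>?W. F w y)\<^sup>2 = (\<Sum>u\<in>?W. \<Sum>v\<in>?W. F u y * F v y)" for y
      by (simp add: power2_eq_square sum_product)
    have sq_int: "integrable \<sigma> (\<lambda>y. (\<Sum>w\<in>?W. F w y)\<^sup>2)"
      unfolding sq by (intro Bochner_Integration.integrable_sum F_int)
    show Z_eq: "Z S = (\<integral>y. (\<Sum>w\<in>?W. cap_density \<rho> (Q S w) y - 1)\<^sup>2 \<partial>\<sigma>)"
    proof -
      have "Z S = (\<Sum>u\<in>?W. \<Sum>v\<in>?W. \<integral>y. F u y * F v y \<partial>\<sigma>)"
        by (simp add: Z_def cap_kernel_def F_def)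
      also have "\<dots> = (\<integral>y. (\<Sum>w\<in>?W. F w y)\<^sup>2 \<partial>\<sigma>)"
        unfolding sq using F_int by simp
      finally show ?thesis by (simp add: F_def)
    qed
    assume Zc: "Z S < c"
    define G where "G = (\<lambda>y. (\<Sum>w\<in>?W. F w y) / card ?W)"
    have G_eq: "G y = (\<Sum>w\<in>?W. cap_density \<rho> (Q S w) y) / card ?W - 1" for y
      using cW by (simp add: G_def F_def sum_subtractf diff_divide_distrib)
    have G_int: "integrable \<sigma> G"
      unfolding G_eq using Qs by (intro Bochner_Integration.integrable_diff integrable_divide
        Bochner_Integration.integrable_sum cap_density_integrable) auto
    have G2_int: "integrable \<sigma> (\<lambda>y. (G y)\<^sup>2)"
      using sq_int by (simp add: G_def power_divide)
    \<comment> \<open>Young's inequality with weight \<eta> replaces Cauchy-Schwarz; the right side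
      is at most \<eta> as soon as the squared norm is at most \<eta>^2.\<close>
    have "(\<integral>y. \<bar>G y\<bar> \<partial>\<sigma>) \<le> (\<integral>y. (\<eta> + (G y)\<^sup>2 / \<eta>) / 2 \<partial>\<sigma>)"
    proof (rule integral_mono)
      fix y
      have "2 * \<bar>G y\<bar> * \<eta> \<le> \<eta>\<^sup>2 + (G y)\<^sup>2"
        using sum_squares_bound[of "\<bar>G y\<bar>" \<eta>] by simp
      then show "\<bar>G y\<bar> \<le> (\<eta> + (G y)\<^sup>2 / \<eta>) / 2"
        using \<eta> by (simp add: field_simps power2_eq_square)
    qed (use G_int G2_int in auto)
    also have "\<dots> = (\<eta> + (\<integral>y. (G y)\<^sup>2 \<partial>\<sigma>) / \<eta>) / 2"
      using G2_int by (simp add: S.prob_space[simplified])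
    also have "(\<integral>y. (G y)\<^sup>2 \<partial>\<sigma>) = Z S / (real (card ?W))\<^sup>2"
      by (simp add: Z_eq G_def F_def power_divide)
    also have "(\<eta> + Z S / (real (card ?W))\<^sup>2 / \<eta>) / 2 \<le> \<eta>"
      using Zc \<eta> cW by (simp add: c_def field_simps power2_eq_square)
    finally have G_le: "(\<integral>y. \<bar>G y\<bar> \<partial>\<sigma>) \<le> \<eta>" .
    have "wasserstein1 \<sigma> (empirical ?W (Q S))
        \<le> ennreal (\<rho> + (\<integral>y. \<bar>(\<Sum>w\<in>?W. cap_density \<rho> (Q S w) y) / card ?W - 1\<bar> \<partial>\<sigma>))"
      using Qs cap_measure_nonneg
      by (intro E.wasserstein1_le_densities cap_density_integrable cap_density_integral pos)
         (auto simp: cap_density_def dist_commute split: if_splits)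
    also have "\<dots> \<le> ennreal (\<rho> + \<eta>)"
      using G_le by (intro ennreal_leI) (simp add: G_eq)
    finally show "S \<in> ?good" using S by simp
  qed
  have Z_nonneg: "Z S \<ge> 0" if "S \<in> space ?P" for S
    unfolding Z_eq[OF that] by (intro integral_nonneg_AE) auto
  let ?N = "2 * l * p"
  let ?A = "real (card {w \<in> words k ?N. \<forall>i. count_list (map fst w) i \<noteq> 1})"
  have Z_bound: "\<bar>Z S\<bar> \<le> card ?W * (card ?W * (1 / cap_measure \<rho>))" if "S \<in> space ?P" for S
    unfolding Z_def using measurable_space[OF Q_m that]
    by (intro order_trans[OF sum_abs] sum_bounded_above order_trans[OF sum_abs] K.K_bound) auto
  have Zp_int: "integrable ?P (\<lambda>S. Z S ^ p)"
    by (rule P.integrable_const_bound[where B = "(card ?W * (card ?W * (1 / cap_measure \<rho>))) ^ p"])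
       (use Z_bound in \<open>auto simp: power_abs intro!: power_mono\<close>)
  \<comment> \<open>\<open>Z\<close> is nonnegative, so p may be odd as well as even.\<close>
  have "P.prob {S \<in> space ?P. Z S ^ p \<ge> c ^ p} \<le> (\<integral>S. Z S ^ p \<partial>?P) / c ^ p"
    using Z_nonneg c0 by (intro integral_Markov_inequality_measure[OF Zp_int, where A = "{}"]) auto
  also have "\<dots> \<le> ((1 / cap_measure \<rho>) ^ p * ?A) / c ^ p"
    using K.moment_bound[of k l p] c0 by (intro divide_right_mono) (auto simp: Z_def Q_def)
  also have "\<dots> = (1 / (cap_measure \<rho> * \<eta>\<^sup>2)) ^ p * ?A / (2 * real k) ^ ?N"
    by (simp add: c_def card_words power_mult_distrib power_divide power_mult[symmetric] mult.commute
        mult.left_commute mult.assoc)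
  finally have tail: "P.prob {S \<in> space ?P. Z S ^ p \<ge> c ^ p} \<le> (1 / (cap_measure \<rho> * \<eta>\<^sup>2)) ^ p * ?A / (2 * real k) ^ ?N" .
  have "space ?P - ?good \<subseteq> {S \<in> space ?P. Z S ^ p \<ge> c ^ p}"
  proof
    fix S assume S: "S \<in> space ?P - ?good"
    then have "c \<le> Z S" using main[of S] by force
    then show "S \<in> {S \<in> space ?P. Z S ^ p \<ge> c ^ p}" using S c0 by (auto intro: power_mono)
  qed
  then have "P.prob (space ?P - ?good) \<le> P.prob {S \<in> space ?P. Z S ^ p \<ge> c ^ p}"
    by (intro P.finite_measure_mono) measurable
  then show ?thesis
    using tail P.prob_compl[OF good_m] by (simp add: orbit)
qed

end

section \<open>Numerical estimates\<close>

text \<open>A weak Stirling bound. The induction step is (n/(n+1))^(n+1) <= 1/e, from ln(1 + x) <= x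
  at x = -1/(n+1).\<close>

lemma fact_upper_bound:
  assumes "n \<ge> 1"
  shows "fact n \<le> exp 1 * real n * (real n / exp 1) ^ n"
  using assms
proof (induction n rule: dec_induct)
  case base
  then show ?case by simp
next
  case (step n)
  have n: "real n > 0" using step by simp
  have "- ln (1 - 1 / (real n + 1)) \<ge> 1 / (real n + 1)"
    using ln_add_one_self_le_self2[of "- (1 / (real n + 1))"] n by (simp add: field_simps)
  moreover have "1 - 1 / (real n + 1) = real n / (real n + 1)" using n by (simp add: field_simps)
  ultimately have "ln (real n / (real n + 1)) * (real n + 1) \<le> - 1"
    using n by (simp add: field_simps)
  then have "exp (ln (real n / (real n + 1)) * (real n + 1)) \<le> exp (- 1)" by simp
  also have "exp (ln (real n / (real n + 1)) * (real n + 1)) = (real n / (real n + 1)) ^ Suc n"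
  proof -
    have "exp (ln (real n / (real n + 1)) * (real n + 1)) = exp (real (Suc n) * ln (real n / (real n + 1)))"
      by (simp add: mult.commute add.commute)
    also have "\<dots> = exp (ln (real n / (real n + 1))) ^ Suc n" by (rule exp_of_nat_mult)
    finally show ?thesis using n by simp
  qed
  finally have "real n ^ Suc n \<le> exp (- 1) * (real n + 1) ^ Suc n"
    using n by (simp only: power_divide pos_divide_le_eq[of "(real n + 1) ^ Suc n"] zero_less_power)
  then have "exp 1 * real n ^ Suc n \<le> exp 1 * (exp (- 1) * (real n + 1) ^ Suc n)"
    by (intro mult_left_mono) auto
  also have "\<dots> = (real n + 1) ^ Suc n"
    by (simp add: exp_minus)
  finally have "exp 1 * real n ^ Suc n \<le> (real n + 1) ^ Suc n" .
  then have key: "real n * (real n / exp 1) ^ n \<le> ((real n + 1) / exp 1) ^ Suc n"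
    by (simp add: power_divide field_simps)
  have "fact (Suc n) = (real n + 1) * fact n" by (simp add: algebra_simps)
  also have "\<dots> \<le> (real n + 1) * (exp 1 * real n * (real n / exp 1) ^ n)"
    using step.IH by (intro mult_left_mono) auto
  also have "\<dots> = exp 1 * (real n + 1) * (real n * (real n / exp 1) ^ n)" by simp
  also have "\<dots> \<le> exp 1 * (real n + 1) * ((real n + 1) / exp 1) ^ Suc n"
    using key by (intro mult_left_mono) auto
  finally show ?case by (simp add: add.commute)
qed

text \<open>The function increases on the interval, and 5/6 is its value at 1/2 with ln 2 lowered to
  2/3. The logarithm is bounded by its tangent at 1/2 up to s = 4/5 and by its tangent at 1
  beyond.\<close>

lemma entropy_lower_bound:
  fixes s :: real
  assumes "1/2 \<le> s" "s \<le> 1"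
  shows "s * (1 - ln s) \<ge> 5/6"
proof (cases "s \<le> 4/5")
  case True
  have "ln (2 * s) \<le> 2 * s - 1" using assms by (intro ln_le_minus_one) auto
  then have "1 - ln s \<ge> 8/3 - 2 * s"
    using assms ln2_ge_two_thirds by (simp add: ln_mult)
  then have "s * (1 - ln s) \<ge> s * (8/3 - 2 * s)" using assms by (intro mult_left_mono) auto
  moreover have "s * (8/3 - 2 * s) - 5/6 = 2 * (s - 1/2) * (5/6 - s)" by (simp add: field_simps)
  moreover have "(s - 1/2) * (5/6 - s) \<ge> 0" using assms True by (intro mult_nonneg_nonneg) auto
  ultimately show ?thesis by linarith
next
  case False
  have "ln s \<le> s - 1" using assms by (intro ln_le_minus_one) auto
  then have "s * (1 - ln s) \<ge> s * (2 - s)" using assms by (intro mult_left_mono) auto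
  moreover have "(1 - s) * (1 - s) \<le> (1/5) * (1/5)" using False assms by (intro mult_mono) auto
  ultimately show ?thesis by (simp add: algebra_simps)
qed

text \<open>With j = lp and s = 8j/k everything collapses to (s/e)^j = exp(-(k/8) s (1 - ln s)). The
  conditions relating k to lp keep s in [1/2, 1], where the entropy bound gives the rate
  5/48.\<close>

lemma moment_tail_numeric:
  fixes B :: real and l p k :: nat
  assumes l: "l \<ge> 1" and p: "p \<ge> 1" and kl: "8 * l * p \<le> k" "k \<le> 16 * l * p"
    and B: "B \<ge> 0" "B * (8 * exp 1 * l) \<le> 2 ^ l"
  shows "B ^ p * card {w \<in> words k (2 * l * p). \<forall>i. count_list (map fst w) i \<noteq> 1} / (2 * real k) ^ (2 * l * p)
    \<le> exp (- 5/48 * k)"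
proof -
  define j where "j = l * p"
  have j: "j \<ge> 1" using l p by (simp add: j_def)
  have "k > 0" using l p kl(1) by (metis One_nat_def Suc_le_lessD bot_nat_0.not_eq_extremum le_zero_eq
        mult_is_0 not_less_eq_eq zero_le zero_neq_numeral)
  then have k: "real k > 0" and kj: "8 * real j \<le> k" "real k \<le> 16 * real j"
    using kl l p by (auto simp: j_def of_nat_mult[symmetric] simp del: of_nat_mult)
  \<comment> \<open>This z minimises exp(k z^2) / z^(2j).\<close>
  define z where "z = sqrt (real j / k)"
  have z: "z > 0" "z\<^sup>2 = real j / k" using j k by (auto simp: z_def)
  have N: "2 * l * p = 2 * j" by (simp add: j_def)
  have "real (card {w \<in> words k (2 * j). \<forall>i. count_list (map fst w) i \<noteq> 1}) / (2 * real k) ^ (2 * j)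
      \<le> (2 * fact (2 * j) * (2 / z) ^ (2 * j) * exp (real k * z\<^sup>2)) / (2 * real k) ^ (2 * j)"
    using z by (intro divide_right_mono card_words_no_single) auto
  also have "\<dots> = 2 * fact (2 * j) * exp 1 ^ j / (real j * k) ^ j"
  proof -
    have "(2 / z) ^ (2 * j) / (2 * real k) ^ (2 * j) = ((2 / z / (2 * real k))\<^sup>2) ^ j"
      by (simp only: power_divide[symmetric] power_mult)
    also have "(2 / z / (2 * real k))\<^sup>2 = 1 / (z\<^sup>2 * (real k)\<^sup>2)"
      by (simp add: power2_eq_square)
    also have "\<dots> ^ j = 1 / (z\<^sup>2 * (real k)\<^sup>2) ^ j" by (simp only: power_one_over)
    also have "z\<^sup>2 * (real k)\<^sup>2 = real j * k" unfolding z(2) using k by (simp add: power2_eq_square)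
    finally have q: "(2 / z) ^ (2 * j) / (2 * real k) ^ (2 * j) = 1 / (real j * k) ^ j" .
    have e: "exp (real k * z\<^sup>2) = exp 1 ^ j"
      using k by (simp add: z(2) exp_of_nat_mult[symmetric])
    have "2 * fact (2 * j) * (2 / z) ^ (2 * j) * exp (real k * z\<^sup>2) / (2 * real k) ^ (2 * j)
        = 2 * fact (2 * j) * exp (real k * z\<^sup>2) * ((2 / z) ^ (2 * j) / (2 * real k) ^ (2 * j))"
      by (simp only: times_divide_eq_right mult_ac)
    then show ?thesis by (simp only: q e times_divide_eq_right mult_1_right)
  qed
  also have "\<dots> \<le> 2 * (exp 1 * real (2 * j) * (real (2 * j) / exp 1) ^ (2 * j)) * exp 1 ^ j / (real j * k) ^ j"
    using fact_upper_bound[of "2 * j"] j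
    by (intro divide_right_mono mult_right_mono mult_left_mono) auto
  also have "\<dots> = 4 * exp 1 * j * (4 * j / (exp 1 * k)) ^ j"
  proof -
    have "(real (2 * j) / exp 1) ^ (2 * j) * exp 1 ^ j / (real j * k) ^ j
        = ((real (2 * j) / exp 1)\<^sup>2 * exp 1 / (real j * k)) ^ j"
      by (simp add: power_mult power_divide power_mult_distrib)
    also have "(real (2 * j) / exp 1)\<^sup>2 * exp 1 / (real j * k) = 4 * j / (exp 1 * k)"
      using j by (simp add: power2_eq_square field_simps)
    finally have q: "(real (2 * j) / exp 1) ^ (2 * j) * exp 1 ^ j / (real j * k) ^ j
        = (4 * j / (exp 1 * k)) ^ j" .
    have "2 * (exp 1 * real (2 * j) * (real (2 * j) / exp 1) ^ (2 * j)) * exp 1 ^ j / (real j * k) ^ j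
        = 4 * exp 1 * j * ((real (2 * j) / exp 1) ^ (2 * j) * exp 1 ^ j / (real j * k) ^ j)"
      by simp
    then show ?thesis by (simp only: q)
  qed
  finally have A: "real (card {w \<in> words k (2 * j). \<forall>i. count_list (map fst w) i \<noteq> 1}) / (2 * real k) ^ (2 * j)
      \<le> 4 * exp 1 * j * (4 * j / (exp 1 * k)) ^ j" .
  \<comment> \<open>The Stirling prefactor 4ej = p (4el) is at most (8el)^p because p <= 2^p. It is
    thus absorbed factor by factor, which explains 8el in the hypothesis on B.\<close>
  have pre: "B ^ p * (4 * exp 1 * j) \<le> 2 ^ j"
  proof -
    have "1 * 1 * 1 \<le> 4 * exp (1::real) * real l"
      using l by (intro mult_mono) auto
    then have e1: "1 \<le> 4 * exp 1 * real l" by simp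
    have "4 * exp 1 * real j = real p * (4 * exp 1 * l)" by (simp add: j_def)
    also have "\<dots> \<le> 2 ^ p * (4 * exp 1 * l) ^ p"
      using e1 p self_le_power[OF e1, of p] of_nat_less_two_power[of p, where 'a = real]
      by (intro mult_mono) auto
    also have "\<dots> = (2 * (4 * exp 1 * l)) ^ p" by (rule power_mult_distrib[symmetric])
    also have "2 * (4 * exp 1 * real l) = 8 * exp 1 * l" by simp
    finally have "B ^ p * (4 * exp 1 * j) \<le> (B * (8 * exp 1 * l)) ^ p"
      unfolding power_mult_distrib[of B] using B(1) by (intro mult_left_mono) auto
    also have "\<dots> \<le> (2 ^ l) ^ p" using B by (intro power_mono) auto
    finally show ?thesis by (simp add: j_def power_mult)
  qed
  define s where "s = 8 * real j / k"
  have s: "1/2 \<le> s" "s \<le> 1" using kj k by (auto simp: s_def field_simps)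
  have "B ^ p * real (card {w \<in> words k (2 * j). \<forall>i. count_list (map fst w) i \<noteq> 1}) / (2 * real k) ^ (2 * j)
      \<le> B ^ p * (4 * exp 1 * j * (4 * j / (exp 1 * k)) ^ j)"
    using mult_left_mono[OF A, of "B ^ p"] B(1) by simp
  also have "\<dots> = (B ^ p * (4 * exp 1 * j)) * (4 * j / (exp 1 * k)) ^ j" by simp
  also have "\<dots> \<le> 2 ^ j * (4 * j / (exp 1 * k)) ^ j"
    using pre by (intro mult_right_mono) auto
  also have "\<dots> = (2 * (4 * j / (exp 1 * k))) ^ j" by (rule power_mult_distrib[symmetric])
  also have "2 * (4 * j / (exp 1 * k)) = s * exp (- 1)"
    by (simp add: s_def exp_minus divide_inverse)
  also have "s * exp (- 1) = exp (- (1 - ln s))"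
    using s by (simp add: exp_diff exp_minus field_simps)
  also have "exp (- (1 - ln s)) ^ j = exp (- (real j * (1 - ln s)))"
    by (simp add: exp_of_nat_mult[symmetric] algebra_simps)
  also have "real j * (1 - ln s) = k / 8 * (s * (1 - ln s))" using k by (simp add: s_def)
  also have "exp (- (k / 8 * (s * (1 - ln s)))) \<le> exp (- (k / 8 * (5/6)))"
    unfolding exp_le_cancel_iff neg_le_iff_le
    using entropy_lower_bound[OF s] k by (intro mult_left_mono) auto
  also have "- (k / 8 * (5/6)) = - 5/48 * real k" by simp
  finally show ?thesis by (simp only: N)
qed

section \<open>Word length and number of generators\<close>

lemma a_const_nonneg:
  assumes "n \<ge> 2"
  shows "a_const n \<ge> 0" and "n = 2 \<Longrightarrow> a_const n \<ge> 1/2"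
proof -
  have log4: "log 2 4 = (2::real)" "log 2 16 = (4::real)"
    using log_pow_cancel[of 2 2] log_pow_cancel[of 2 4] by simp_all
  have "log 2 4 \<le> log 2 (5 * real n)"
    using assms by (subst log_le_cancel_iff) auto
  then have ge: "log 2 (5 * real n) \<ge> 2" by (simp only: log4)
  have "log 2 2 \<le> log 2 (log 2 (5 * real n))"
    using ge by (subst log_le_cancel_iff) auto
  then have lg: "log 2 (log 2 (5 * real n)) \<ge> 1" by simp
  then show "a_const n \<ge> 0" using ge by (simp add: a_const_def)
  assume n: "n = 2"
  have "log 2 (5 * real n) \<le> log 2 16"
    unfolding n by (subst log_le_cancel_iff) auto
  then have "log 2 (5 * real n) \<le> 4" by (simp only: log4)
  then show "a_const n \<ge> 1/2"
  proof -
    assume le: "log 2 (5 * real n) \<le> 4"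
    have "1/2 * log 2 (5 * real n) \<le> 2 * log 2 (log 2 (5 * real n))" using le lg by linarith
    then show ?thesis unfolding a_const_def using ge by (subst pos_le_divide_eq) auto
  qed
qed

text \<open>The radius r enters through l: its upper bound makes words long enough to beat the cap
  density, its lower bound keeps them short enough for k to exceed 8l.\<close>

lemma parameter_bounds:
  fixes n k l :: nat and \<epsilon> \<delta> r :: real
  defines "L \<equiv> log 2 (1 / \<epsilon>)"
  assumes n: "n \<ge> 2" and \<epsilon>: "0 < \<epsilon>" and \<delta>: "0 < \<delta>" "\<delta> \<le> 1"
    and r: "\<epsilon> \<le> r" "r \<le> \<epsilon> powr (1 - 1 / real n)"
    and L: "L \<ge> 2 + 2 * ln (fact n)"
    and k: "real k \<ge> 8 * ln 2 * ((real n + 4) + 2 * ln (1 / \<delta>)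
        + 6 * real n * (1 + a_const n) * ln (1 / \<epsilon>) - ln (fact n))"
    and l: "int l = \<lceil>real n / 2 * log 2 (1 / (r * \<epsilon>)) + (4 + 3 * a_const n) * log 2 (1 / \<epsilon>)\<rceil>"
  shows "(real n + 7/2) * L \<le> real l" and "8 * l \<le> k" and "exp (- 5/48 * k) \<le> \<delta>"
proof -
  define a where "a = a_const n"
  define f where "f = ln (fact n :: real)"
  have a0: "a \<ge> 0" and a2: "n = 2 \<Longrightarrow> a \<ge> 1/2"
    using a_const_nonneg[OF n] by (auto simp: a_def)
  have f0: "f \<ge> 0" unfolding f_def by (simp add: fact_ge_1)
  have L0: "L \<ge> 2" using L f0 unfolding f_def by linarith
  have lne: "ln (1 / \<epsilon>) = ln 2 * L" by (simp add: L_def log_def)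
  have loge: "log 2 \<epsilon> = - L" using \<epsilon> by (simp add: L_def log_divide)
  have rpos: "r > 0" using \<epsilon> r by simp
  have "log 2 \<epsilon> \<le> log 2 r" using \<epsilon> r rpos by (subst log_le_cancel_iff) auto
  moreover have "log 2 r \<le> log 2 (\<epsilon> powr (1 - 1 / real n))" using \<epsilon> r rpos by (subst log_le_cancel_iff) auto
  ultimately have lr: "- L \<le> log 2 r" "log 2 r \<le> - ((1 - 1 / real n) * L)"
    using \<epsilon> by (simp_all add: log_powr loge algebra_simps)
  define t where "t = real n / 2 * log 2 (1 / (r * \<epsilon>)) + (4 + 3 * a) * L"
  have lg: "log 2 (1 / (r * \<epsilon>)) = L - log 2 r"
    using \<epsilon> rpos by (simp add: log_divide log_mult loge)
  have "int l = \<lceil>t\<rceil>" using l by (simp only: t_def a_def L_def)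
  then have "real l = of_int \<lceil>t\<rceil>" by (metis of_int_of_nat_eq)
  then have lt: "t \<le> real l" "real l \<le> t + 1"
    using le_of_int_ceiling[of t] of_int_ceiling_le_add_one[of t] by simp_all
  \<comment> \<open>The exponent 1 - 1/n costs L/2, so this part gives (n - 1/2) L and the summand
    4L raises it to (n + 7/2) L.\<close>
  have "real n / 2 * log 2 (1 / (r * \<epsilon>)) \<ge> real n / 2 * (L + (1 - 1 / real n) * L)"
    unfolding lg using lr by (intro mult_left_mono) linarith+
  also have "real n / 2 * (L + (1 - 1 / real n) * L) = (real n - 1/2) * L"
    using n by (simp add: field_simps)
  finally have "t \<ge> (real n - 1/2) * L + (4 + 3 * a) * L" by (simp add: t_def)
  moreover have "a * L \<ge> 0" using a0 L0 by simp
  ultimately show "(real n + 7/2) * L \<le> real l"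
    using lt(1) by (simp add: algebra_simps)
  have "real n / 2 * log 2 (1 / (r * \<epsilon>)) \<le> real n / 2 * (2 * L)"
    unfolding lg using lr by (intro mult_left_mono) auto
  then have l_up: "real l \<le> (real n + 4 + 3 * a) * L + 1"
    using lt(2) by (simp add: t_def algebra_simps)
  define Y where "Y = real n * (1 + a) * L"
  define D where "D = ln (1 / \<delta>)"
  have D0: "D \<ge> 0" unfolding D_def using \<delta> by simp
  have ln2: "2/3 \<le> ln (2::real)" "ln (2::real) \<le> 1"
    using ln2_ge_two_thirds ln2_le_25_over_36 by auto
  have k': "real k \<ge> 8 * ln 2 * ((real n + 4) + 2 * D + 6 * ln 2 * Y - f)"
  proof -
    have "6 * real n * (1 + a_const n) * ln (1 / \<epsilon>) = 6 * ln 2 * Y"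
      unfolding lne Y_def a_def by (simp only: mult_ac)
    then show ?thesis using k by (simp only: D_def f_def)
  qed
  have Y_ge: "Y \<ge> 2 * L"
  proof -
    have "2 * 1 * L \<le> real n * (1 + a) * L" using n a0 L0 by (intro mult_right_mono mult_mono) auto
    then show ?thesis by (simp add: Y_def)
  qed
  have rest: "6 * ln 2 * Y - f \<ge> 0"
  proof -
    have "6 * (2/3) * (2 * L) \<le> 6 * ln 2 * Y" using ln2 Y_ge L0 by (intro mult_mono) auto
    then show ?thesis using L f0 L0 unfolding f_def by linarith
  qed
  \<comment> \<open>The term 2D alone yields k >= (32/3) D, and 5/48 of that is (10/9) D;
    \<open>rest\<close> makes the discarded terms nonnegative.\<close>
  show "exp (- 5/48 * k) \<le> \<delta>"
  proof -
    have "8 * (2/3) * (2 * D) \<le> 8 * ln 2 * ((real n + 4) + 2 * D + 6 * ln 2 * Y - f)"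
      using ln2 D0 rest by (intro mult_mono) auto
    then have "5/48 * k \<ge> D" using k' D0 by simp
    then have "exp (- 5/48 * k) \<le> exp (- D)" by simp
    also have "\<dots> = \<delta>" using \<delta> by (simp add: D_def ln_div)
    finally show ?thesis .
  qed
  \<comment> \<open>Here 64/3 is 48 times (2/3)^2, from ln 2 >= 2/3 used twice. The additional 4L >=
    8 + 8f pays for rounding up l and for ln(n!). At n = 2 the inequality between the coefficients
    is equivalent to a >= 1/2.\<close>
  have coef: "(8 * (real n + 4 + 3 * a) + 4) * L \<le> 64/3 * Y"
  proof -
    have "8 * (real n + 4 + 3 * a) + 4 \<le> 64/3 * (real n * (1 + a))"
    proof (cases "n = 2")
      case True
      then show ?thesis using a2 by simp
    next
      case False
      then have "3 * a \<le> real n * a" using n a0 by (intro mult_right_mono) auto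
      then show ?thesis using False n a0 by (simp add: algebra_simps)
    qed
    then have "(8 * (real n + 4 + 3 * a) + 4) * L \<le> 64/3 * (real n * (1 + a)) * L"
      using L0 by (intro mult_right_mono) auto
    then show ?thesis by (simp add: Y_def)
  qed
  have "(2/3) * (2/3) * Y \<le> ln 2 * ln 2 * Y"
    using ln2 Y_ge L0 by (intro mult_right_mono mult_mono) auto
  moreover have "ln 2 * f \<le> 1 * f" using ln2 f0 by (intro mult_right_mono) auto
  moreover have "ln 2 * ((real n + 4) + 2 * D) \<ge> 0" using ln2 D0 by simp
  ultimately have "real k \<ge> 64/3 * Y - 8 * f"
    using k' by (simp add: algebra_simps)
  then have "real (8 * l) \<le> real k"
    using l_up coef L by (simp add: f_def algebra_simps)
  then show "8 * l \<le> k" by (simp only: of_nat_le_iff)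
qed

text \<open>The radius is \<epsilon> times the square root of a logarithm, so any loss c > 0 in the
  exponent suffices; c = 1/n costs only half a unit in the coefficient of the word length.\<close>

lemma eventually_radius_le:
  fixes A :: real
  assumes "n \<ge> 1" "A > 0"
  shows "eventually (\<lambda>\<epsilon>. 2 * \<epsilon> * sqrt (ln (A / \<epsilon> ^ (2 * n - 1))) \<le> \<epsilon> powr (1 - 1 / real n)) (at_right 0)"
proof -
  have "eventually (\<lambda>\<epsilon>. 2 * \<epsilon> * sqrt (ln A - real (2 * n - 1) * ln \<epsilon>) \<le> \<epsilon> powr (1 - c)) (at_right 0)"
    if "c > 0" for c :: real
    using that assms by real_asymp
  from this[of "1 / real n"]
  have "eventually (\<lambda>\<epsilon>. 2 * \<epsilon> * sqrt (ln A - real (2 * n - 1) * ln \<epsilon>) \<le> \<epsilon> powr (1 - 1 / real n)) (at_right 0)"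
    using assms by simp
  moreover have "eventually (\<lambda>\<epsilon>::real. \<epsilon> > 0) (at_right 0)"
    by (simp add: eventually_at_right_less)
  ultimately show ?thesis
    by eventually_elim (use assms in \<open>simp add: ln_div ln_realpow\<close>)
qed

lemma eventually_linear_le_powr:
  fixes c \<kappa> :: real
  assumes "\<kappa> > 0"
  shows "eventually (\<lambda>l::nat. c * real l \<le> 2 powr (\<kappa> * real l)) sequentially"
  using assms by real_asymp

text \<open>The error is split evenly between the cap radius and the L1 deviation. With the
  pigeonhole bound, B is at most a constant times (1/\<epsilon>)^(n+3), of which the exponent 2
  stems from the square of \<rho>.\<close>

lemma (in haar_SO) orbit_measure_close:
  fixes n k l :: nat and \<epsilon> \<delta> :: real
  defines "L \<equiv> log 2 (1 / \<epsilon>)"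
  assumes card: "CARD('n) = n + 1" and \<epsilon>: "0 < \<epsilon>" "\<epsilon> \<le> 1" and x0: "x0 \<in> unit_sphere"
    and l: "(real n + 7/2) * L \<le> real l" "l \<ge> 1"
    and l_large: "(4 * real n + 7) ^ (n + 1) * 32 * exp 1 * real l \<le> 2 powr (1 / (2 * real n + 7) * real l)"
    and k: "8 * l \<le> k" and \<delta>: "exp (- 5/48 * k) \<le> \<delta>"
  shows "\<P>(S in (\<Pi>\<^sub>M i\<in>{..<k}. \<mu>). wasserstein1 \<sigma> (orbit_measure S k l x0) \<le> ennreal \<epsilon>) \<ge> 1 - \<delta>"
proof -
  define \<rho> where "\<rho> = \<epsilon> / 2"
  have \<rho>: "\<rho> > 0" using \<epsilon> by (simp add: \<rho>_def)
  \<comment> \<open>The mesh must satisfy (n + 1)/m <= \<rho> = \<epsilon>/2.\<close>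
  define m where "m = nat \<lceil>2 * (real n + 1) / \<epsilon>\<rceil>"
  have q: "2 * (real n + 1) / \<epsilon> > 0" using \<epsilon> by simp
  have m1: "2 * (real n + 1) / \<epsilon> \<le> real m" and m2: "real m \<le> 2 * (real n + 1) / \<epsilon> + 1"
    using q by (simp_all add: m_def)
  have m0: "m > 0" using q m1 by linarith
  have "real CARD('n) \<le> \<rho> * real m"
    using m1 \<epsilon> by (simp add: card \<rho>_def field_simps)
  then have low: "1 \<le> (2 * real m + 1) ^ CARD('n) * cap_measure \<rho>"
    using m0 by (rule cap_measure_lower)
  have pos: "cap_measure \<rho> > 0"
    using low cap_measure_nonneg[of \<rho>] by (cases "cap_measure \<rho> = 0") auto
  have "2 * real m + 1 \<le> (4 * real n + 7) / \<epsilon>"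
    using m2 \<epsilon> by (simp add: field_simps)
  then have "(2 * real m + 1) ^ (n + 1) \<le> ((4 * real n + 7) / \<epsilon>) ^ (n + 1)"
    by (intro power_mono) auto
  moreover have "1 / cap_measure \<rho> \<le> (2 * real m + 1) ^ (n + 1)"
    using low pos by (simp add: card pos_divide_le_eq)
  ultimately have inv: "1 / cap_measure \<rho> \<le> ((4 * real n + 7) / \<epsilon>) ^ (n + 1)" by linarith
  define B where "B = 1 / (cap_measure \<rho> * \<rho>\<^sup>2)"
  have B0: "B \<ge> 0" using pos by (simp add: B_def)
  have "B = 1 / cap_measure \<rho> * (4 * (1 / \<epsilon>)\<^sup>2)"
    by (simp add: B_def \<rho>_def power_divide)
  also have "\<dots> \<le> ((4 * real n + 7) / \<epsilon>) ^ (n + 1) * (4 * (1 / \<epsilon>)\<^sup>2)"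
    using inv by (intro mult_right_mono) auto
  also have "\<dots> = (4 * real n + 7) ^ (n + 1) * 4 * (1 / \<epsilon>) ^ (n + 3)"
    by (simp add: power_divide power_add power2_eq_square power3_eq_cube)
  finally have B_le: "B \<le> (4 * real n + 7) ^ (n + 1) * 4 * (1 / \<epsilon>) ^ (n + 3)" .
  have "(1 / \<epsilon>) ^ (n + 3) = 2 powr (L * (real n + 3))"
    using \<epsilon> by (simp add: L_def powr_powr[symmetric] powr_realpow[symmetric] add.commute)
  also have "\<dots> \<le> 2 powr ((1 - 1 / (2 * real n + 7)) * real l)"
  proof -
    \<comment> \<open>The gap between n + 3 and n + 7/2 is a fraction 1/(2n + 7) of the length; the
      resulting factor 2^(l/(2n+7)) absorbs the constant and the linear term in l.\<close>
    have "L * (real n + 3) = (1 - 1 / (2 * real n + 7)) * ((real n + 7/2) * L)"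
      by (simp add: field_simps)
    also have "\<dots> \<le> (1 - 1 / (2 * real n + 7)) * real l"
      using l(1) by (intro mult_left_mono) auto
    finally show ?thesis by simp
  qed
  finally have e_le: "(1 / \<epsilon>) ^ (n + 3) \<le> 2 powr ((1 - 1 / (2 * real n + 7)) * real l)" .
  have "B * (8 * exp 1 * l) \<le> ((4 * real n + 7) ^ (n + 1) * 4 * (1 / \<epsilon>) ^ (n + 3)) * (8 * exp 1 * l)"
    using B_le by (intro mult_right_mono) auto
  also have "\<dots> = ((4 * real n + 7) ^ (n + 1) * 32 * exp 1 * real l) * (1 / \<epsilon>) ^ (n + 3)"
    by simp
  also have "\<dots> \<le> 2 powr (1 / (2 * real n + 7) * real l) * 2 powr ((1 - 1 / (2 * real n + 7)) * real l)"
    using l_large e_le \<epsilon> by (intro mult_mono) auto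
  also have "\<dots> = 2 ^ l"
    by (simp add: powr_add[symmetric] powr_realpow[symmetric] algebra_simps)
  finally have B: "B * (8 * exp 1 * l) \<le> 2 ^ l" .
  \<comment> \<open>Since p >= 1, rounding down loses at most a factor 2, which keeps lp between
    k/16 and k/8.\<close>
  define p where "p = k div (8 * l)"
  have p1: "p \<ge> 1" using k l(2) by (simp add: p_def div_greater_zero_iff Suc_leI)
  have p2: "8 * l * p \<le> k" unfolding p_def by (metis mult.commute div_times_less_eq_dividend)
  have "k < 8 * l * (p + 1)"
    unfolding p_def using l(2) dividend_less_times_div[of "8 * l" k] by simp
  also have "\<dots> \<le> 8 * l * (2 * p)" using p1 by (intro mult_left_mono) auto
  finally have p3: "k \<le> 16 * l * p" by simp
  let ?A = "real (card {w \<in> words k (2 * l * p). \<forall>i. count_list (map fst w) i \<noteq> 1})"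
  have "1 - \<delta> \<le> 1 - exp (- 5/48 * k)" using \<delta> by simp
  also have "\<dots> \<le> 1 - B ^ p * ?A / (2 * real k) ^ (2 * l * p)"
    using moment_tail_numeric[OF l(2) p1 p2 p3 B0 B] by simp
  also have "\<dots> \<le> \<P>(S in (\<Pi>\<^sub>M i\<in>{..<k}. \<mu>). wasserstein1 \<sigma> (orbit_measure S k l x0) \<le> ennreal (\<rho> + \<rho>))"
    unfolding B_def using k l(2) by (intro wasserstein1_orbit_tail pos x0 \<rho>) auto
  finally show ?thesis by (simp add: \<rho>_def)
qed

theorem theorem4p14:
  fixes n :: nat and C :: real
  assumes "n > 1" and "CARD('n::finite) = n + 1"
  shows "\<exists>\<epsilon>\<^sub>0>0. \<exists>\<delta>\<^sub>0>0. \<exists>r\<^sub>0>0.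
    \<forall>(\<mu> :: (real^'n^'n) measure) (H :: real \<Rightarrow> real^'n \<Rightarrow> real^'n \<Rightarrow> real).
      is_haar_SO \<mu> \<and> is_heat_kernel (sphere_measure \<mu>) H \<and> heat_kernel_bound n H C \<longrightarrow>
      (\<forall>(\<epsilon>::real) (\<delta>::real) (r::real) (k::nat) (l::nat) (x\<^sub>0 :: real^'n).
         0 < \<epsilon> \<and> \<epsilon> \<le> \<epsilon>\<^sub>0 \<and> 0 < \<delta> \<and> \<delta> \<le> \<delta>\<^sub>0 \<and>
         r = 2 * \<epsilon> * sqrt (ln (3 * (1 + C) / \<epsilon> ^ (2 * n - 1))) \<and>
         real k \<ge> 8 * ln 2 * ((real n + 4) + 2 * ln (1 / \<delta>)
                    + 6 * real n * (1 + a_const n) * ln (1 / \<epsilon>) - ln (fact n)) \<and>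
         x\<^sub>0 \<in> unit_sphere \<and>
         int l = \<lceil>real n / 2 * log 2 (1 / (r * \<epsilon>)) + (4 + 3 * a_const n) * log 2 (1 / \<epsilon>)\<rceil> \<and>
         r \<le> r\<^sub>0 \<longrightarrow>
         \<P>(S in (\<Pi>\<^sub>M i\<in>{..<k}. \<mu>).
             wasserstein1 (sphere_measure \<mu>) (orbit_measure S k l x\<^sub>0) \<le> ennreal \<epsilon>) \<ge> 1 - \<delta>)"
proof -
  \<comment> \<open>C is fixed before any heat kernel is given, so its sign is unknown when the
    constants are chosen; \<open>max\<close> keeps A positive until \<open>heat_kernel_bound\<close>
    supplies C > 0.\<close>
  define A where "A = 3 * (1 + max 0 C)"
  have A: "A \<ge> 3" by (simp add: A_def)
  obtain l0 where l0: "\<And>l. l \<ge> l0 \<Longrightarrow>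
      (4 * real n + 7) ^ (n + 1) * 32 * exp 1 * real l \<le> 2 powr (1 / (2 * real n + 7) * real l)"
    using eventually_linear_le_powr[of "1 / (2 * real n + 7)" "(4 * real n + 7) ^ (n + 1) * 32 * exp 1"]
    unfolding eventually_sequentially by auto
  \<comment> \<open>One threshold on log_2(1/\<epsilon>) serves both purposes: it makes l at least
    \<open>l0\<close>, and it provides the lower bound on L in
    \<open>parameter_bounds\<close>.\<close>
  define X where "X = max (real l0) (2 + 2 * ln (fact n))"
  have "filterlim (\<lambda>\<epsilon>::real. log 2 (1 / \<epsilon>)) at_top (at_right 0)" by real_asymp
  then have evX: "eventually (\<lambda>\<epsilon>. X \<le> log 2 (1 / \<epsilon>)) (at_right 0)" by (simp add: filterlim_at_top)
  have "eventually (\<lambda>\<epsilon>. 2 * \<epsilon> * sqrt (ln (A / \<epsilon> ^ (2 * n - 1))) \<le> \<epsilon> powr (1 - 1 / real n) \<and>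
      X \<le> log 2 (1 / \<epsilon>)) (at_right 0)"
    using assms A evX by (intro eventually_conj eventually_radius_le) auto
  then obtain b where b: "b > 0" "\<And>\<epsilon>. 0 < \<epsilon> \<Longrightarrow> \<epsilon> < b \<Longrightarrow>
      2 * \<epsilon> * sqrt (ln (A / \<epsilon> ^ (2 * n - 1))) \<le> \<epsilon> powr (1 - 1 / real n) \<and> X \<le> log 2 (1 / \<epsilon>)"
    unfolding eventually_at_right_field by auto
  \<comment> \<open>The estimates hold for \<epsilon> < b strictly, whereas \<epsilon> may equal its
    upper bound; hence b/2.\<close>
  define \<epsilon>\<^sub>0 where "\<epsilon>\<^sub>0 = min 1 (b / 2)"
  have main: "\<P>(S in (\<Pi>\<^sub>M i\<in>{..<k}. \<mu>).
      wasserstein1 (sphere_measure \<mu>) (orbit_measure S k l x\<^sub>0) \<le> ennreal \<epsilon>) \<ge> 1 - \<delta>"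
    if \<mu>: "is_haar_SO \<mu>" and H: "heat_kernel_bound n H C"
      and \<epsilon>: "0 < \<epsilon>" "\<epsilon> \<le> \<epsilon>\<^sub>0" and \<delta>: "0 < \<delta>" "\<delta> \<le> 1"
      and r: "r = 2 * \<epsilon> * sqrt (ln (3 * (1 + C) / \<epsilon> ^ (2 * n - 1)))"
      and k: "real k \<ge> 8 * ln 2 * ((real n + 4) + 2 * ln (1 / \<delta>)
                    + 6 * real n * (1 + a_const n) * ln (1 / \<epsilon>) - ln (fact n))"
      and x0: "x\<^sub>0 \<in> unit_sphere"
      and l: "int l = \<lceil>real n / 2 * log 2 (1 / (r * \<epsilon>)) + (4 + 3 * a_const n) * log 2 (1 / \<epsilon>)\<rceil>"
    for \<mu> :: "(real^'n^'n) measure" and H :: "real \<Rightarrow> real^'n \<Rightarrow> real^'n \<Rightarrow> real"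
      and \<epsilon> \<delta> r k l and x\<^sub>0 :: "real^'n"
  proof -
    have "C > 0" using H by (simp add: heat_kernel_bound_def)
    then have rA: "r = 2 * \<epsilon> * sqrt (ln (A / \<epsilon> ^ (2 * n - 1)))" by (simp add: r A_def)
    have e1: "\<epsilon> \<le> 1" and eb: "\<epsilon> < b" using \<epsilon> b(1) by (auto simp: \<epsilon>\<^sub>0_def)
    have r_up: "r \<le> \<epsilon> powr (1 - 1 / real n)" and XL: "X \<le> log 2 (1 / \<epsilon>)"
      using b(2)[OF \<epsilon>(1) eb] by (auto simp: rA)
    \<comment> \<open>As 3 > e, the logarithm is at least 1, which gives r >= \<epsilon>.\<close>
    have "3 \<le> A / \<epsilon> ^ (2 * n - 1)"
    proof -
      have "\<epsilon> ^ (2 * n - 1) \<le> 1" using \<epsilon>(1) e1 by (simp add: power_le_one)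
      then have "A / 1 \<le> A / \<epsilon> ^ (2 * n - 1)" using A \<epsilon>(1) by (intro divide_left_mono) auto
      then show ?thesis using A by simp
    qed
    then have "exp 1 \<le> A / \<epsilon> ^ (2 * n - 1)" using exp_le by linarith
    then have "1 \<le> ln (A / \<epsilon> ^ (2 * n - 1))" by (simp add: ln_ge_iff less_le_trans[OF exp_gt_zero])
    then have "1 \<le> sqrt (ln (A / \<epsilon> ^ (2 * n - 1)))" by simp
    then have "\<epsilon> * 1 \<le> 2 * \<epsilon> * sqrt (ln (A / \<epsilon> ^ (2 * n - 1)))" using \<epsilon>(1) by (intro mult_mono) auto
    then have r_low: "\<epsilon> \<le> r" by (simp add: rA)
    have n2: "n \<ge> 2" using assms by simp
    have "log 2 (1 / \<epsilon>) \<ge> 2 + 2 * ln (fact n)" using XL by (simp add: X_def)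
    note pb = parameter_bounds[OF n2 \<epsilon>(1) \<delta> r_low r_up this k l]
    have "1 * log 2 (1 / \<epsilon>) \<le> (real n + 7/2) * log 2 (1 / \<epsilon>)"
      using e1 \<epsilon>(1) by (intro mult_right_mono) auto
    then have lX: "X \<le> real l" using pb(1) XL by linarith
    then have "l \<ge> l0" by (simp add: X_def)
    have "ln (fact n :: real) \<ge> 0" by (simp add: fact_ge_1)
    then have "real l \<ge> 1" using lX unfolding X_def by linarith
    then have l1: "l \<ge> 1" by simp
    interpret haar_SO \<mu>
      using \<mu> assms by (auto simp: haar_SO_def haar_SO_axioms_def is_haar_SO_def)
    show ?thesis
      using pb(1) l1 l0[OF \<open>l \<ge> l0\<close>] pb(2,3) assms(2)
      by (intro orbit_measure_close[where n = n]) (use \<epsilon> e1 x0 in auto)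
  qed
  show ?thesis
    using b(1) main
    by (intro exI[of _ \<epsilon>\<^sub>0] exI[of _ "1::real"] conjI) (auto simp: \<epsilon>\<^sub>0_def)
qed

end
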